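(* Let $(\mathcal{X},d)$ be a complete, separable, and geodesic metric space. Let $1<p<\infty$ and $0<\alpha<1$. Then for every $\mu,\nu\in P_p(\mathcal{X})$, $$W_p^p(\mu,\nu)=\big(1-2^{-(p-\alpha p)}\big)\min\left\{\int_{C([0,1];\mathcal{X})}|\gamma|_{b^{\alpha,p}}^p\,d\pi(\gamma):\ \pi\in P(C([0,1];\mathcal{X})),\ (e_0)_\#\pi=\mu,\ (e_1)_\#\pi=\nu\right\}$$ (in particular the minimum is attained). In addition, an admissible $\pi$ is a minimizer if and only if $(e_0,e_1)_\#\pi\in\mathrm{OptCpl}(\mu,\nu)$ and $\pi(Geo([0,1];\mathcal{X}))=1$.
   Context: $C([0,1];\mathcal{X})$ is the space of continuous paths with the supremum distance and its Borel $\sigma$-algebra; $P(\mathcal{Y})$ denotes Borel probability measures on $\mathcal{Y}$; $e_t(\gamma)=\gamma_t$. $P_p(\mathcal{X})$ is the set of Borel probability measures with finite $p$-th moment, with the $p$-Wasserstein distance $W_p$; $\mathrm{OptCpl}(\mu,\nu)$ is the set of couplings optimal for the cost $d(x,y)^p$. $Geo([0,1];\mathcal{X})$ is the set of constant-speed geodesics, i.e. $\gamma:[0,1]\to\mathcal{X}$ with $d(\gamma_s,\gamma_t)=|t-s|\,d(\gamma_0,\gamma_1)$ for all $s,t\in[0,1]$. A metric space is geodesic if any two points can be joined by a constant-speed geodesic. For $\gamma:[0,1]\to\mathcal{X}$, $$|\gamma|_{b^{\alpha,p}}=\Big(\sum_{m=0}^\infty 2^{m(\alpha p-1)}\sum_{k=0}^{2^m-1}d\big(\gamma_{k/2^m},\gamma_{(k+1)/2^m}\big)^p\Big)^{1/p}\in[0,+\infty].$$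 *)

theory Defs
  imports "HOL-Probability.Probability"
begin

text \<open>
  The power $x^a$ on $[0,\infty]$, meant for exponents $a > 0$, so that
  $0^a = 0$ and $\infty^a = \infty$.
\<close>

definition enn_powr :: "ennreal \<Rightarrow> real \<Rightarrow> ennreal" where
  "enn_powr x a = (if x = \<infinity> then \<infinity> else ennreal (enn2real x powr a))"

lemma measurable_enn_powr [measurable]: "(\<lambda>x. enn_powr x a) \<in> borel_measurable borel"
  unfolding enn_powr_def by measurable

definition borel_probs :: "'a::topological_space measure set" where
  "borel_probs = {M. prob_space M \<and> sets M = sets borel}"

text \<open>
  The interval $[0,1]$ is made a type, so that the path space is the library type of
  (automatically bounded) continuous functions on it, with the supremum distance.
\<close>

typedef unit_interval = "{0..1::real}"
  by (rule exI[of _ 0]) simp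

instantiation unit_interval :: metric_space
begin

definition dist_unit_interval :: "unit_interval \<Rightarrow> unit_interval \<Rightarrow> real" where
  "dist_unit_interval s t = dist (Rep_unit_interval s) (Rep_unit_interval t)"

definition uniformity_unit_interval :: "(unit_interval \<times> unit_interval) filter" where
  "uniformity_unit_interval = (INF e\<in>{0 <..}. principal {(s, t). dist s t < e})"

definition open_unit_interval :: "unit_interval set \<Rightarrow> bool" where
  "open_unit_interval S \<longleftrightarrow> (\<forall>s\<in>S. \<forall>\<^sub>F (s', t) in uniformity. s' = s \<longrightarrow> t \<in> S)"

instance
  by standard
    (auto simp: dist_unit_interval_def Rep_unit_interval_inject
      uniformity_unit_interval_def open_unit_interval_def intro: dist_triangle2)

end

type_synonym 'a path_space = "(unit_interval, 'a) bcontfun"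

text \<open>
  The evaluation $e_t(\gamma) = \gamma_t$, to be used only for $t \in [0,1]$.
\<close>

definition eval_at :: "real \<Rightarrow> 'a::metric_space path_space \<Rightarrow> 'a" where
  "eval_at t \<gamma> = apply_bcontfun \<gamma> (Abs_unit_interval t)"

text \<open>
  Under this encoding the elements of \<^typ>\<open>'a path_space\<close> are exactly the restrictions to
  $[0,1]$ of functions that are continuous there, and the distance is the supremum distance.
\<close>

lemma continuous_on_Abs_unit_interval: "continuous_on {0..1} Abs_unit_interval"
  by (auto simp: continuous_on_iff dist_unit_interval_def Abs_unit_interval_inverse)

lemma continuous_on_eval_at: "continuous_on {0..1} (\<lambda>t. eval_at t \<gamma>)"
  unfolding eval_at_def
  by (rule continuous_on_compose2[OF continuous_on_apply_bcontfun[of UNIV]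
        continuous_on_Abs_unit_interval]) simp

lemma ex_path:
  fixes f :: "real \<Rightarrow> 'a::metric_space"
  assumes "continuous_on {0..1} f"
  shows "\<exists>\<gamma>. \<forall>t\<in>{0..1}. eval_at t \<gamma> = f t"
proof -
  have "continuous_on UNIV Rep_unit_interval"
    by (auto simp: continuous_on_iff dist_unit_interval_def)
  then have "continuous_on UNIV (\<lambda>s. f (Rep_unit_interval s))"
    by (rule continuous_on_compose2[OF assms]) (use Rep_unit_interval in auto)
  moreover have "range (\<lambda>s. f (Rep_unit_interval s)) \<subseteq> f ` {0..1}"
    using Rep_unit_interval by auto
  then have "bounded (range (\<lambda>s. f (Rep_unit_interval s)))"
    using compact_continuous_image[OF assms] bounded_subset compact_imp_bounded by blast
  ultimately have "(\<lambda>s. f (Rep_unit_interval s)) \<in> bcontfun"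
    by (simp add: bcontfun_def)
  then show ?thesis
    by (intro exI[of _ "Bcontfun (\<lambda>s. f (Rep_unit_interval s))"])
      (auto simp: eval_at_def Bcontfun_inverse Abs_unit_interval_inverse)
qed

lemma dist_path_space: "dist \<gamma> \<eta> = (SUP t\<in>{0..1}. dist (eval_at t \<gamma>) (eval_at t \<eta>))"
proof -
  have *: "UNIV = Abs_unit_interval ` {0..1}"
    using Abs_unit_interval_cases by blast
  show ?thesis
    unfolding dist_bcontfun.rep_eq eval_at_def by (subst *) (simp add: image_image)
qed

lemma continuous_eval_at: "continuous_on UNIV (eval_at t)"
  unfolding continuous_on_iff eval_at_def
  by (blast intro: dist_fun_lt_imp_dist_val_lt)

lemma measurable_eval_at [measurable]: "eval_at t \<in> borel_measurable borel"
  by (rule borel_measurable_continuous_onI[OF continuous_eval_at])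

definition constant_speed_geodesic :: "(real \<Rightarrow> 'a::metric_space) \<Rightarrow> bool" where
  "constant_speed_geodesic \<gamma> \<longleftrightarrow>
     (\<forall>s\<in>{0..1}. \<forall>t\<in>{0..1}. dist (\<gamma> s) (\<gamma> t) = \<bar>t - s\<bar> * dist (\<gamma> 0) (\<gamma> 1))"

definition geodesic_space :: "'a::metric_space itself \<Rightarrow> bool" where
  "geodesic_space _ \<longleftrightarrow>
     (\<forall>x y :: 'a. \<exists>\<gamma>. constant_speed_geodesic \<gamma> \<and> \<gamma> 0 = x \<and> \<gamma> 1 = y)"

definition Geo :: "'a::metric_space path_space set" where
  "Geo = {\<gamma>. constant_speed_geodesic (\<lambda>t. eval_at t \<gamma>)}"

lemma closed_Geo: "closed (Geo :: 'a::metric_space path_space set)"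
proof -
  have "Geo = (\<Inter>s\<in>{0..1}. \<Inter>t\<in>{0..1}. {\<gamma> :: 'a path_space.
      dist (eval_at s \<gamma>) (eval_at t \<gamma>) = \<bar>t - s\<bar> * dist (eval_at 0 \<gamma>) (eval_at 1 \<gamma>)})"
    by (auto simp: Geo_def constant_speed_geodesic_def)
  also have "closed \<dots>"
    by (intro closed_INT ballI closed_Collect_eq continuous_intros continuous_eval_at)
  finally show ?thesis .
qed

definition P_moment :: "real \<Rightarrow> 'a::metric_space measure set" where
  "P_moment p = {\<mu> \<in> borel_probs. \<exists>x0. (\<integral>\<^sup>+ x. ennreal (dist x x0 powr p) \<partial>\<mu>) < \<infinity>}"

definition Cpl :: "'a::metric_space measure \<Rightarrow> 'a measure \<Rightarrow> ('a \<times> 'a) measure set" where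
  "Cpl \<mu> \<nu> = {\<theta> \<in> borel_probs. distr \<theta> borel fst = \<mu> \<and> distr \<theta> borel snd = \<nu>}"

definition transport_cost :: "real \<Rightarrow> ('a::metric_space \<times> 'a) measure \<Rightarrow> ennreal" where
  "transport_cost p \<theta> = (\<integral>\<^sup>+ (x, y). ennreal (dist x y powr p) \<partial>\<theta>)"

definition OptCpl :: "real \<Rightarrow> 'a::metric_space measure \<Rightarrow> 'a measure \<Rightarrow> ('a \<times> 'a) measure set" where
  "OptCpl p \<mu> \<nu> = {\<theta>. is_arg_min (transport_cost p) (\<lambda>\<theta>. \<theta> \<in> Cpl \<mu> \<nu>) \<theta>}"

definition Wasserstein :: "real \<Rightarrow> 'a::metric_space measure \<Rightarrow> 'a measure \<Rightarrow> ennreal" where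
  "Wasserstein p \<mu> \<nu> = enn_powr (INF \<theta>\<in>Cpl \<mu> \<nu>. transport_cost p \<theta>) (1 / p)"

definition besov :: "real \<Rightarrow> real \<Rightarrow> 'a::metric_space path_space \<Rightarrow> ennreal" where
  "besov \<alpha> p \<gamma> = enn_powr
     (\<Sum>m. ennreal (2 powr (real m * (\<alpha> * p - 1))) *
       (\<Sum>k<2 ^ m. ennreal
         (dist (eval_at (real k / 2 ^ m) \<gamma>) (eval_at (real (k + 1) / 2 ^ m) \<gamma>) powr p)))
     (1 / p)"

lemma measurable_besov [measurable]: "besov \<alpha> p \<in> borel_measurable borel"
proof -
  have [measurable]: "(\<lambda>\<gamma>::'a path_space. dist (eval_at s \<gamma>) (eval_at t \<gamma>)) \<in> borel_measurable borel"
    for s t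
    by (intro borel_measurable_continuous_onI continuous_intros continuous_eval_at)
  show ?thesis
    unfolding besov_def by measurable
qed

definition path_energy :: "real \<Rightarrow> real \<Rightarrow> 'a::metric_space path_space measure \<Rightarrow> ennreal" where
  "path_energy \<alpha> p \<pi> = (\<integral>\<^sup>+ \<gamma>. enn_powr (besov \<alpha> p \<gamma>) p \<partial>\<pi>)"

definition path_plans ::
    "'a::metric_space measure \<Rightarrow> 'a measure \<Rightarrow> 'a path_space measure set" where
  "path_plans \<mu> \<nu> =
     {\<pi> \<in> borel_probs. distr \<pi> borel (eval_at 0) = \<mu> \<and> distr \<pi> borel (eval_at 1) = \<nu>}"

end

(*
  By the power mean inequality the m-th dyadic level of the Besov energy of a path from x to y is at
  least r^m d(x,y)^p with r = 2^(-(p - alpha p)), and equality at every level forces the dyadic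
  increments to be equal, hence makes the path a constant speed geodesic.  Summing the geometric
  series and integrating bounds the energy of a plan from below by the transport cost of its
  endpoint coupling, so it remains to find a plan on geodesics above an optimal coupling.

  An optimal coupling exists: a cluster point (for setwise convergence) of a minimizing sequence is
  a finitely additive set function with tight marginals, hence countably additive on rectangles,
  and Fatou's lemma gives the lower semicontinuity of the cost.  It lifts to geodesics
  because the endpoint map from Geo has a Borel section almost everywhere: a capacity argument
  finds compact subsets of Geo with images of measure close to 1, and on a compact set a section
  is obtained by successively choosing the first small ball that meets the fibre.
*)
theory Submission
  imports Defs
begin

section \<open>Existence of optimal couplings\<close>

text \<open>Compactness and measurability, not the inequality, shape the proof. The cluster point is
  known to agree with the coupling built from it only on rectangles, so the cost must be
  approximated from below by finite combinations of rectangles before Fatou's lemma can act. On the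
  geodesic side, the image of a closed set of paths under the endpoint map need not be Borel; hence
  the capacity argument works with outer measure, and the section is asked only for almost every
  pair under the one coupling that is lifted. The separability it uses is that of
  \<open>Geo\<close>: a geodesic is determined up to a small error by finitely many of its
  positions. The constant 1 - r is the reciprocal of the sum of the powers of r: a geodesic of
  length one has energy 1 / (1 - r). Being neither zero nor infinite, it can be cancelled when
  energies are compared. The characterization of minimizers subtracts integrals, and this is where
  finite p-th moments enter.\<close>

lemma cluster_point_bounded_functions:
  fixes f :: "nat \<Rightarrow> 'i \<Rightarrow> real"
  assumes "\<And>n i. f n i \<in> {a..b}"
  obtains G :: "('i \<Rightarrow> real) filter" and m where "G \<noteq> bot"
    and "\<And>i. ((\<lambda>g. g i) \<longlongrightarrow> m i) G"
    and "\<And>N. eventually (\<lambda>g. \<exists>n\<ge>N. g = f n) G"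
proof -
  let ?U = "PiE UNIV (\<lambda>_. {a..b}) :: ('i \<Rightarrow> real) set"
  let ?F = "filtermap f sequentially"
  have "compactin (product_topology (\<lambda>_. euclidean) UNIV) ?U"
    by (subst compactin_PiE) simp
  then have "compact ?U"
    by (simp add: euclidean_product_topology)
  moreover have "?F \<noteq> bot"
    by (simp add: filtermap_bot_iff)
  moreover have "eventually (\<lambda>g. g \<in> ?U) ?F"
    using assms by (simp add: eventually_filtermap PiE_UNIV_domain)
  ultimately obtain m where m: "inf (nhds m) ?F \<noteq> bot"
    unfolding compact_filter by blast
  show thesis
  proof (rule that[OF m])
    fix i
    have "((\<lambda>g :: 'i \<Rightarrow> real. g i) \<longlongrightarrow> m i) (nhds m)"
    proof (rule topological_tendstoI)
      fix S :: "real set" assume S: "open S" "m i \<in> S"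
      have "open ((\<lambda>g :: 'i \<Rightarrow> real. g i) -` S)"
        by (rule open_vimage[OF S(1) continuous_on_product_coordinates])
      with S(2) show "eventually (\<lambda>g. g i \<in> S) (nhds m)"
        unfolding eventually_nhds by blast
    qed
    then show "((\<lambda>g. g i) \<longlongrightarrow> m i) (inf (nhds m) ?F)"
      by (rule tendsto_mono[rotated]) simp
  next
    fix N
    have "eventually (\<lambda>g. \<exists>n\<ge>N. g = f n) ?F"
      unfolding eventually_filtermap eventually_sequentially by auto
    then show "eventually (\<lambda>g. \<exists>n\<ge>N. g = f n) (inf (nhds m) ?F)"
      by (rule filter_leD[rotated]) simp
  qed
qed

lemma compact_approx_borel:
  fixes M :: "'a::polish_space measure" and e :: real
  assumes "finite_measure M" and M: "sets M = sets borel" and A: "A \<in> sets borel" and "e > 0"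
  obtains K where "compact K" "K \<subseteq> A" "measure M (A - K) < e"
proof -
  interpret finite_measure M by fact
  have eq: "emeasure M A = (SUP K \<in> {K. K \<subseteq> A \<and> compact K}. emeasure M K)"
    using inner_regular[OF M _ A] by simp
  have ne: "{K. K \<subseteq> A \<and> compact K} \<noteq> {}"
    by auto
  have fin: "emeasure M A \<noteq> \<infinity>"
    by simp
  from SUP_approx_ennreal[OF \<open>e > 0\<close> ne eq fin]
  obtain K where K: "K \<subseteq> A" "compact K" "emeasure M A < emeasure M K + e"
    by auto
  have "K \<in> sets M" using K M by (auto intro: borel_compact)
  then have "measure M (A - K) = measure M A - measure M K"
    using A K M by (intro finite_measure_Diff) auto
  moreover have "measure M A < measure M K + e"
    using K(3) \<open>e > 0\<close> by (simp add: emeasure_eq_measure ennreal_less_iff flip: ennreal_plus)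
  ultimately show thesis using K that by auto
qed

lemma open_approx_borel:
  fixes M :: "'a::polish_space measure" and e :: real
  assumes "finite_measure M" and M: "sets M = sets borel" and A: "A \<in> sets borel" and "e > 0"
  obtains U where "open U" "A \<subseteq> U" "measure M (U - A) < e"
proof -
  interpret finite_measure M by fact
  have "emeasure M A = (INF U \<in> {U. A \<subseteq> U \<and> open U}. emeasure M U)"
    using outer_regular[OF M _ A] by simp
  from INF_approx_ennreal[OF \<open>e > 0\<close> this]
  obtain U where U: "A \<subseteq> U" "open U" "emeasure M U < emeasure M A + e"
    by auto
  have "measure M (U - A) = measure M U - measure M A"
    using A U M by (intro finite_measure_Diff) auto
  moreover have "measure M U < measure M A + e"
    using U(3) \<open>e > 0\<close> by (simp add: emeasure_eq_measure ennreal_less_iff flip: ennreal_plus)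
  ultimately show thesis using U that by auto
qed

text \<open>Caratheodory's extension theorem applies to a semiring, which confines the later check
  of countable additivity to single rectangles.\<close>

lemma semiring_of_sets_rectangles:
  "semiring_of_sets UNIV {A \<times> B | A B. A \<in> sets M \<and> B \<in> sets N}"
proof
  fix a b assume "a \<in> {A \<times> B | A B. A \<in> sets M \<and> B \<in> sets N}" "b \<in> {A \<times> B | A B. A \<in> sets M \<and> B \<in> sets N}"
  then obtain A B A' B' where a: "a = A \<times> B" "b = A' \<times> B'"
    and [measurable]: "A \<in> sets M" "B \<in> sets N" "A' \<in> sets M" "B' \<in> sets N" by auto
  show "a \<inter> b \<in> {A \<times> B | A B. A \<in> sets M \<and> B \<in> sets N}"
    unfolding a Times_Int_Times by (intro CollectI exI conjI refl) measurable
  show "\<exists>C\<subseteq>{A \<times> B | A B. A \<in> sets M \<and> B \<in> sets N}. finite C \<and> disjoint C \<and> a - b = \<Union> C"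
  proof (intro exI[of _ "{(A - A') \<times> B, (A \<inter> A') \<times> (B - B')}"] conjI)
    show "{(A - A') \<times> B, (A \<inter> A') \<times> (B - B')} \<subseteq> {A \<times> B | A B. A \<in> sets M \<and> B \<in> sets N}"
      by (intro insert_subsetI empty_subsetI CollectI exI conjI refl) measurable
    show "a - b = \<Union> {(A - A') \<times> B, (A \<inter> A') \<times> (B - B')}"
      unfolding a by auto
  qed (auto simp: disjoint_def)
qed auto

text \<open>
  A finitely additive coupling is countably additive on rectangles, by compactness, since
  rectangles inherit inner and outer regularity from the marginals alone.
\<close>

lemma finitely_additive_coupling_extends:
  fixes m :: "('a::polish_space \<times> 'b::polish_space) set \<Rightarrow> real"
  assumes "finite_measure \<mu>" and sets_mu: "sets \<mu> = sets borel"
    and "finite_measure \<nu>" and sets_nu: "sets \<nu> = sets borel"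
    and nonneg: "\<And>S. S \<in> sets borel \<Longrightarrow> 0 \<le> m S"
    and add: "\<And>S T. S \<in> sets borel \<Longrightarrow> T \<in> sets borel \<Longrightarrow> S \<inter> T = {} \<Longrightarrow> m (S \<union> T) = m S + m T"
    and marg1: "\<And>A. A \<in> sets borel \<Longrightarrow> m (A \<times> UNIV) = measure \<mu> A"
    and marg2: "\<And>B. B \<in> sets borel \<Longrightarrow> m (UNIV \<times> B) = measure \<nu> B"
  obtains \<theta> where "sets \<theta> = sets borel"
    "\<And>A B. A \<in> sets borel \<Longrightarrow> B \<in> sets borel \<Longrightarrow> emeasure \<theta> (A \<times> B) = ennreal (m (A \<times> B))"
proof -
  interpret mu: finite_measure \<mu> by fact
  interpret nu: finite_measure \<nu> by fact
  let ?R = "{A \<times> B | A B. A \<in> sets borel \<and> B \<in> sets borel} :: ('a \<times> 'b) set set"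
  interpret R: semiring_of_sets UNIV ?R by (rule semiring_of_sets_rectangles)
  have rect [measurable, intro]: "A \<times> B \<in> sets borel" if "A \<in> sets borel" "B \<in> sets borel"
    for A :: "'a set" and B :: "'b set"
    using pair_measureI[OF that] unfolding borel_prod .
  have R_borel: "S \<in> sets borel" if "S \<in> ?R" for S
    using that rect by auto
  have empty: "m {} = 0" using add[of "{}" "{}"] by simp
  have mono: "m S \<le> m T" if "S \<subseteq> T" "S \<in> sets borel" "T \<in> sets borel" for S T
    using add[of S "T - S"] nonneg[of "T - S"] that by (simp add: Un_absorb1)
  have Un_le: "m (S \<union> T) \<le> m S + m T" if "S \<in> sets borel" "T \<in> sets borel" for S T
    using add[of S "T - S"] mono[of "T - S" T] that by simp
  have UN_le: "m (\<Union>i\<in>I. S i) \<le> (\<Sum>i\<in>I. m (S i))"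
    if "finite I" "\<And>i. i \<in> I \<Longrightarrow> S i \<in> sets borel" for I :: "nat set" and S
    using that
  proof (induction I)
    case (insert i I)
    then show ?case using Un_le[of "S i" "\<Union>i\<in>I. S i"] by fastforce
  qed (simp add: empty)
  have UN_eq: "m (\<Union>i<n. S i) = (\<Sum>i<n. m (S i))"
    if "disjoint_family S" "\<And>i. S i \<in> sets borel" for n :: nat and S
  proof (induction n)
    case (Suc n)
    have "S i \<inter> S n = {}" if "i < n" for i
      using disjoint_family_onD[OF \<open>disjoint_family S\<close>, of i n] that by simp
    then have "(\<Union>i<n. S i) \<inter> S n = {}"
      by blast
    then have "m ((\<Union>i<n. S i) \<union> S n) = m (\<Union>i<n. S i) + m (S n)"
      using that(2) by (intro add) auto
    then show ?case
      using Suc by (simp add: lessThan_Suc Un_commute)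
  qed (simp add: empty)
  have "countably_additive ?R (\<lambda>S. ennreal (m S))"
  proof (rule countably_additiveI)
    fix S :: "nat \<Rightarrow> ('a \<times> 'b) set"
    assume S: "range S \<subseteq> ?R" "disjoint_family S" "(\<Union>i. S i) \<in> ?R"
    have S_borel [measurable]: "S i \<in> sets borel" for i
      using S(1) by (intro R_borel) blast
    show "(\<Sum>i. ennreal (m (S i))) = ennreal (m (\<Union>i. S i))"
    proof (rule antisym)
      show "(\<Sum>i. ennreal (m (S i))) \<le> ennreal (m (\<Union>i. S i))"
        unfolding suminf_eq_SUP
      proof (rule SUP_least)
        fix n
        have "(\<Sum>i<n. ennreal (m (S i))) = ennreal (m (\<Union>i<n. S i))"
          using S(2) nonneg by (subst UN_eq) (auto intro!: sum_ennreal)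
        also have "\<dots> \<le> ennreal (m (\<Union>i. S i))"
          by (intro ennreal_leI mono) auto
        finally show "(\<Sum>i<n. ennreal (m (S i))) \<le> ennreal (m (\<Union>i. S i))" .
      qed
      show "ennreal (m (\<Union>i. S i)) \<le> (\<Sum>i. ennreal (m (S i)))"
      proof (rule ennreal_le_epsilon)
        fix e :: real assume e: "e > 0"
        obtain P Q where PQ: "(\<Union>i. S i) = P \<times> Q" and [measurable]: "P \<in> sets borel" "Q \<in> sets borel"
          using S(3) by auto
        \<comment> \<open>Half of \<open>e\<close> pays for shrinking P x Q to a compact rectangle,
          a quarter per factor. The other half pays for enlarging the \<open>S i\<close> to open
          sets, weighted by a geometric series.\<close>
        have "e / 4 > 0" using e by simp
        obtain K where K: "compact K" "K \<subseteq> P" "measure \<mu> (P - K) < e / 4"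
          using compact_approx_borel[OF assms(1) sets_mu \<open>P \<in> sets borel\<close> \<open>e / 4 > 0\<close>] .
        obtain L where L: "compact L" "L \<subseteq> Q" "measure \<nu> (Q - L) < e / 4"
          using compact_approx_borel[OF assms(3) sets_nu \<open>Q \<in> sets borel\<close> \<open>e / 4 > 0\<close>] .
        have [measurable]: "K \<in> sets borel" "L \<in> sets borel"
          using K L by (auto intro: borel_compact)
        \<comment> \<open>The remainder is covered by two strips, on which \<open>m\<close> is a
          marginal mass. The same device bounds the enlargement of each \<open>S i\<close>
          below.\<close>
        have "m (P \<times> Q) \<le> m (K \<times> L \<union> ((P - K) \<times> UNIV \<union> UNIV \<times> (Q - L)))"
          by (intro mono) (auto intro!: sets.Un)
        also have "\<dots> \<le> m (K \<times> L) + (m ((P - K) \<times> UNIV) + m (UNIV \<times> (Q - L)))"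
          by (intro order_trans[OF Un_le] add_left_mono Un_le) (auto intro!: sets.Un)
        also have "\<dots> \<le> m (K \<times> L) + e / 2"
          using K L by (simp add: marg1 marg2)
        finally have PQ_le: "m (P \<times> Q) \<le> m (K \<times> L) + e / 2" .
        have "\<exists>U. open U \<and> S i \<subseteq> U \<and> m U \<le> m (S i) + e / 2 * (1 / 2) ^ Suc i" for i
        proof -
          define d where "d = e / 4 * (1 / 2) ^ Suc i"
          have d: "d > 0" using e by (simp add: d_def)
          obtain A B where AB: "S i = A \<times> B" and [measurable]: "A \<in> sets borel" "B \<in> sets borel"
            using S(1) by blast
          obtain U where U: "open U" "A \<subseteq> U" "measure \<mu> (U - A) < d"
            using open_approx_borel[OF assms(1) sets_mu \<open>A \<in> sets borel\<close> d] .
          obtain V where V: "open V" "B \<subseteq> V" "measure \<nu> (V - B) < d"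
            using open_approx_borel[OF assms(3) sets_nu \<open>B \<in> sets borel\<close> d] .
          have [measurable]: "U \<in> sets borel" "V \<in> sets borel" using U V by auto
          have "m (U \<times> V) \<le> m (A \<times> B \<union> ((U - A) \<times> UNIV \<union> UNIV \<times> (V - B)))"
            by (intro mono) (auto intro!: sets.Un)
          also have "\<dots> \<le> m (A \<times> B) + (m ((U - A) \<times> UNIV) + m (UNIV \<times> (V - B)))"
            by (intro order_trans[OF Un_le] add_left_mono Un_le) (auto intro!: sets.Un)
          also have "\<dots> \<le> m (A \<times> B) + 2 * d"
            using U V by (simp add: marg1 marg2)
          finally show ?thesis
            using U V by (intro exI[of _ "U \<times> V"]) (auto simp: AB d_def open_Times)
        qed
        then obtain U where U: "\<And>i. open (U i)" "\<And>i. S i \<subseteq> U i"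
          and mU: "\<And>i. m (U i) \<le> m (S i) + e / 2 * (1 / 2) ^ Suc i" by metis
        have "K \<times> L \<subseteq> (\<Union>i. U i)"
          using Sigma_mono[OF K(2) L(2)] UN_mono[OF order_refl U(2)] unfolding PQ[symmetric]
          by (rule order_trans)
        then obtain D where D: "finite D" "K \<times> L \<subseteq> (\<Union>i\<in>D. U i)"
          using compactE_image[OF compact_Times[OF K(1) L(1)], of UNIV U] U(1) by auto
        have "m (K \<times> L) \<le> m (\<Union>i\<in>D. U i)"
          using D U(1) by (intro mono) (auto intro!: borel_open)
        also have "\<dots> \<le> (\<Sum>i\<in>D. m (U i))"
          using D U(1) by (intro UN_le) auto
        also have "\<dots> \<le> (\<Sum>i\<in>D. m (S i) + e / 2 * (1 / 2) ^ Suc i)"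
          by (intro sum_mono mU)
        also have "\<dots> = (\<Sum>i\<in>D. m (S i)) + e / 2 * (\<Sum>i\<in>D. (1 / 2) ^ Suc i)"
          by (simp add: sum.distrib sum_distrib_left)
        also have "(\<Sum>i\<in>D. (1 / 2 :: real) ^ Suc i) \<le> 1"
          using D(1) power_half_series
          by (intro sum_le_suminf[THEN order_trans]) (auto simp: sums_iff)
        finally have "m (P \<times> Q) \<le> (\<Sum>i\<in>D. m (S i)) + e"
          using PQ_le e by simp
        then have "ennreal (m (P \<times> Q)) \<le> ennreal ((\<Sum>i\<in>D. m (S i)) + e)"
          by (rule ennreal_leI)
        also have "\<dots> = (\<Sum>i\<in>D. ennreal (m (S i))) + ennreal e"
          using nonneg e by (subst ennreal_plus) (auto simp: sum_nonneg sum_ennreal)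
        also have "\<dots> \<le> (\<Sum>i. ennreal (m (S i))) + ennreal e"
          using D(1) by (intro add_right_mono sum_le_suminf) auto
        finally show "ennreal (m (\<Union>i. S i)) \<le> (\<Sum>i. ennreal (m (S i))) + ennreal e"
          by (simp add: PQ)
      qed
    qed
  qed
  moreover have "positive ?R (\<lambda>S. ennreal (m S))"
    by (simp add: positive_def empty)
  ultimately have "\<exists>\<theta>'. (\<forall>S\<in>?R. \<theta>' S = ennreal (m S)) \<and> measure_space UNIV (sigma_sets UNIV ?R) \<theta>'"
    by (intro R.caratheodory)
  then obtain \<theta>' where \<theta>': "\<forall>S\<in>?R. \<theta>' S = ennreal (m S)"
    and ms: "measure_space UNIV (sigma_sets UNIV ?R) \<theta>'"
    by (elim exE conjE)
  have sets_eq: "sigma_sets UNIV ?R = sets (borel :: ('a \<times> 'b) measure)"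
    unfolding borel_prod[symmetric] sets_pair_measure by simp
  show thesis
  proof (rule that[of "measure_of UNIV ?R \<theta>'"])
    show "sets (measure_of UNIV ?R \<theta>') = sets borel"
      using sets_eq by (subst sets_measure_of) auto
    fix A B assume AB: "A \<in> sets (borel :: 'a measure)" "B \<in> sets (borel :: 'b measure)"
    then have "A \<times> B \<in> ?R" by auto
    with ms show "emeasure (measure_of UNIV ?R \<theta>') (A \<times> B) = ennreal (m (A \<times> B))"
      using sets_eq
      by (subst emeasure_measure_of[OF refl]) (auto simp: measure_space_def \<theta>' sets_measure_of)
  qed
qed

section \<open>Lower semicontinuity of the transport cost and the optimal coupling\<close>

lemma dense_sequence:
  obtains D :: "nat \<Rightarrow> 'a::{metric_space, second_countable_topology}"
  where "\<And>x e. e > 0 \<Longrightarrow> \<exists>i. dist x (D i) < e"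
proof -
  obtain D :: "'a set" where D: "countable D" "\<And>X. open X \<Longrightarrow> X \<noteq> {} \<Longrightarrow> \<exists>d\<in>D. d \<in> X"
    using countable_dense_exists by blast
  have "D \<noteq> {}" using D(2)[of UNIV] by auto
  then have range: "range (from_nat_into D) = D"
    using D(1) by (rule range_from_nat_into)
  show thesis
  proof (rule that[of "from_nat_into D"])
    fix x :: 'a and e :: real assume "e > 0"
    then have "\<exists>d\<in>D. d \<in> ball x e" by (intro D(2)) auto
    then show "\<exists>i. dist x (from_nat_into D i) < e"
      using range by (metis mem_ball imageE)
  qed
qed

text \<open>Fatou's lemma in the form needed for lower semicontinuity; it is applied first to the
  truncation \<open>N\<close> and then to the mesh of the partition.\<close>

lemma nn_integral_LIMSEQ_le:
  fixes g :: "nat \<Rightarrow> 'b \<Rightarrow> ennreal"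
  assumes "\<And>n. g n \<in> borel_measurable M"
    and lim: "\<And>x. (\<lambda>n. g n x) \<longlonglongrightarrow> g' x"
    and le: "\<And>n. (\<integral>\<^sup>+x. g n x \<partial>M) \<le> W"
  shows "(\<integral>\<^sup>+x. g' x \<partial>M) \<le> W"
proof -
  have "(\<integral>\<^sup>+x. g' x \<partial>M) = (\<integral>\<^sup>+x. liminf (\<lambda>n. g n x) \<partial>M)"
    using lim_imp_Liminf[OF trivial_limit_sequentially lim] by simp
  also have "\<dots> \<le> liminf (\<lambda>n. \<integral>\<^sup>+x. g n x \<partial>M)"
    by (rule nn_integral_liminf) fact
  also have "\<dots> \<le> limsup (\<lambda>n. \<integral>\<^sup>+x. g n x \<partial>M)"
    by (rule Liminf_le_Limsup) simp
  also have "\<dots> \<le> W"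
    by (rule Limsup_bounded) (simp add: le)
  finally show ?thesis .
qed

text \<open>The cells are disjoint, so at most one term survives at a given point.\<close>

lemma sum_indicator_cells:
  fixes a :: "nat \<Rightarrow> nat \<Rightarrow> ennreal"
  shows "(\<Sum>i<N. \<Sum>j<N. a i j * indicator ((\<phi> -` {i}) \<times> (\<psi> -` {j})) (x, y)) =
    (if \<phi> x < N \<and> \<psi> y < N then a (\<phi> x) (\<psi> y) else 0)"
proof -
  have "a i j * indicator ((\<phi> -` {i}) \<times> (\<psi> -` {j})) (x, y) =
      (if i = \<phi> x then (if j = \<psi> y then a i j else 0) else 0)" for i j
    by (auto simp: indicator_def)
  moreover have "(\<Sum>j<N. if i = \<phi> x then (if j = \<psi> y then a i j else 0) else 0) =
      (if i = \<phi> x then (if \<psi> y < N then a i (\<psi> y) else 0) else 0)" for i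
    by simp
  ultimately show ?thesis
    by simp
qed

lemma distr_pair_measure_marginals:
  assumes "\<mu> \<in> borel_probs" "\<nu> \<in> borel_probs"
  shows "distr (\<mu> \<Otimes>\<^sub>M \<nu>) borel fst = \<mu>" "distr (\<mu> \<Otimes>\<^sub>M \<nu>) borel snd = \<nu>"
proof -
  interpret mu: prob_space \<mu> using assms by (simp add: borel_probs_def)
  interpret nu: prob_space \<nu> using assms by (simp add: borel_probs_def)
  have sets: "sets \<mu> = sets borel" "sets \<nu> = sets borel"
    using assms by (auto simp: borel_probs_def)
  have sp: "space \<mu> = UNIV" "space \<nu> = UNIV"
    using sets[THEN sets_eq_imp_space_eq] by auto
  show "distr (\<mu> \<Otimes>\<^sub>M \<nu>) borel fst = \<mu>"
  proof (rule measure_eqI)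
    fix A assume "A \<in> sets (distr (\<mu> \<Otimes>\<^sub>M \<nu>) borel fst)"
    then have A: "A \<in> sets \<mu>" by (simp add: sets)
    have "emeasure (distr (\<mu> \<Otimes>\<^sub>M \<nu>) borel fst) A = emeasure (\<mu> \<Otimes>\<^sub>M \<nu>) (fst -` A \<inter> space (\<mu> \<Otimes>\<^sub>M \<nu>))"
      using A by (intro emeasure_distr) (auto simp: sets measurable_cong_sets[OF refl sets(1)[symmetric]])
    also have "fst -` A \<inter> space (\<mu> \<Otimes>\<^sub>M \<nu>) = A \<times> space \<nu>"
      by (auto simp: space_pair_measure sp)
    also have "emeasure (\<mu> \<Otimes>\<^sub>M \<nu>) (A \<times> space \<nu>) = emeasure \<mu> A"
      using A by (simp add: nu.emeasure_pair_measure_Times nu.emeasure_space_1)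
    finally show "emeasure (distr (\<mu> \<Otimes>\<^sub>M \<nu>) borel fst) A = emeasure \<mu> A" .
  qed (simp add: sets)
  show "distr (\<mu> \<Otimes>\<^sub>M \<nu>) borel snd = \<nu>"
  proof (rule measure_eqI)
    fix A assume "A \<in> sets (distr (\<mu> \<Otimes>\<^sub>M \<nu>) borel snd)"
    then have A: "A \<in> sets \<nu>" by (simp add: sets)
    have "emeasure (distr (\<mu> \<Otimes>\<^sub>M \<nu>) borel snd) A = emeasure (\<mu> \<Otimes>\<^sub>M \<nu>) (snd -` A \<inter> space (\<mu> \<Otimes>\<^sub>M \<nu>))"
      using A by (intro emeasure_distr) (auto simp: sets measurable_cong_sets[OF refl sets(2)[symmetric]])
    also have "snd -` A \<inter> space (\<mu> \<Otimes>\<^sub>M \<nu>) = space \<mu> \<times> A"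
      by (auto simp: space_pair_measure sp)
    also have "emeasure (\<mu> \<Otimes>\<^sub>M \<nu>) (space \<mu> \<times> A) = emeasure \<nu> A"
      using A by (simp add: nu.emeasure_pair_measure_Times mu.emeasure_space_1)
    finally show "emeasure (distr (\<mu> \<Otimes>\<^sub>M \<nu>) borel snd) A = emeasure \<nu> A" .
  qed (simp add: sets)
qed

lemma pair_measure_in_Cpl:
  fixes \<mu> \<nu> :: "'a::polish_space measure"
  assumes "\<mu> \<in> borel_probs" "\<nu> \<in> borel_probs"
  shows "\<mu> \<Otimes>\<^sub>M \<nu> \<in> Cpl \<mu> \<nu>"
proof -
  interpret mu: prob_space \<mu> using assms by (simp add: borel_probs_def)
  interpret nu: prob_space \<nu> using assms by (simp add: borel_probs_def)
  interpret pair_prob_space \<mu> \<nu> ..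
  have "sets (\<mu> \<Otimes>\<^sub>M \<nu>) = sets (borel \<Otimes>\<^sub>M borel :: ('a \<times> 'a) measure)"
    using assms by (intro sets_pair_measure_cong) (auto simp: borel_probs_def)
  then have "sets (\<mu> \<Otimes>\<^sub>M \<nu>) = sets borel"
    unfolding borel_prod .
  then show ?thesis
    using distr_pair_measure_marginals[OF assms] prob_space_axioms
    by (simp add: Cpl_def borel_probs_def)
qed

text \<open>Finite combinations of masses of rectangles pass from the minimizing sequence to the
  limit, so the cost is approached from below by step functions \<open>g n N\<close> on products of
  cells. Their integrals stay below the infimum, and letting first \<open>N\<close> and then
  \<open>n\<close> grow gives the bound for the cost itself.\<close>

lemma OptCpl_nonempty:
  fixes \<mu> \<nu> :: "'a::polish_space measure" and p :: real
  assumes mu: "\<mu> \<in> borel_probs" and nu: "\<nu> \<in> borel_probs" and p: "p > 0"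
  obtains \<theta> where "\<theta> \<in> OptCpl p \<mu> \<nu>"
proof -
  have sets_mu: "sets \<mu> = sets borel" and sets_nu: "sets \<nu> = sets borel"
    and prob: "prob_space \<mu>" "prob_space \<nu>"
    using mu nu by (auto simp: borel_probs_def)
  define c where "c = (\<lambda>(x :: 'a, y). ennreal (dist x y powr p))"
  have cost: "transport_cost p \<theta> = (\<integral>\<^sup>+z. c z \<partial>\<theta>)" for \<theta>
    by (simp add: transport_cost_def c_def)
  have "transport_cost p ` Cpl \<mu> \<nu> \<noteq> {}"
    using pair_measure_in_Cpl[OF mu nu] by blast
  from ennreal_Inf_countable_INF[OF this] obtain f where f: "decseq f"
    "range f \<subseteq> transport_cost p ` Cpl \<mu> \<nu>"
    "(INF \<theta>\<in>Cpl \<mu> \<nu>. transport_cost p \<theta>) = (INF i. f i)"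
    by auto
  have "\<forall>n. \<exists>\<theta>\<in>Cpl \<mu> \<nu>. transport_cost p \<theta> = f n"
    using f(2) by (metis (no_types, lifting) imageE rangeI subsetD)
  then obtain \<theta>s where \<theta>s: "\<And>n. \<theta>s n \<in> Cpl \<mu> \<nu>" "\<And>n. transport_cost p (\<theta>s n) = f n"
    by metis
  have prob_s: "prob_space (\<theta>s n)" and sets_s: "sets (\<theta>s n) = sets borel"
    and fst_s: "distr (\<theta>s n) borel fst = \<mu>" and snd_s: "distr (\<theta>s n) borel snd = \<nu>" for n
    using \<theta>s(1)[of n] by (auto simp: Cpl_def borel_probs_def)
  have space_s: "space (\<theta>s n) = UNIV" for n
    using sets_eq_imp_space_eq[OF sets_s] by simp
  obtain G :: "(('a \<times> 'a) set \<Rightarrow> real) filter" and m where G: "G \<noteq> bot"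
    and m: "\<And>S. ((\<lambda>g. g S) \<longlongrightarrow> m S) G"
    and ev: "\<And>N. eventually (\<lambda>g. \<exists>n\<ge>N. g = measure (\<theta>s n)) G"
  proof (rule cluster_point_bounded_functions[of "\<lambda>n. measure (\<theta>s n)" 0 1])
    show "measure (\<theta>s n) S \<in> {0..1}" for n S
      using prob_space.prob_le_1[OF prob_s] by simp
  qed blast
  have nonneg: "0 \<le> m S" for S
    by (rule tendsto_lowerbound[OF m _ G], rule eventually_mono[OF ev[of 0]]) auto
  have add: "m (S \<union> T) = m S + m T" if "S \<in> sets borel" "T \<in> sets borel" "S \<inter> T = {}" for S T
  proof (rule tendsto_unique[OF G m])
    have "eventually (\<lambda>g. g S + g T = g (S \<union> T)) G"
    proof (rule eventually_mono[OF ev[of 0]], elim exE conjE)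
      fix g n assume g: "g = measure (\<theta>s n)"
      interpret prob_space "\<theta>s n" by (rule prob_s)
      show "g S + g T = g (S \<union> T)"
        unfolding g using that by (subst finite_measure_Union) (auto simp: sets_s)
    qed
    then show "((\<lambda>g. g (S \<union> T)) \<longlongrightarrow> m S + m T) G"
      by (rule Lim_transform_eventually[OF tendsto_add[OF m m]])
  qed
  have marg1: "m (A \<times> UNIV) = measure \<mu> A" if A: "A \<in> sets borel" for A
  proof (rule tendsto_unique[OF G m])
    have "measure (\<theta>s n) (A \<times> UNIV) = measure \<mu> A" for n
    proof -
      have "measure (distr (\<theta>s n) borel fst) A = measure (\<theta>s n) (fst -` A \<inter> space (\<theta>s n))"
        using A by (intro measure_distr)
          (auto simp: measurable_cong_sets[OF sets_s refl] borel_prod[symmetric])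
      also have "fst -` A \<inter> space (\<theta>s n) = A \<times> UNIV" by (auto simp: space_s)
      finally show ?thesis by (simp add: fst_s)
    qed
    then have "eventually (\<lambda>g. measure \<mu> A = g (A \<times> UNIV)) G"
      by (intro eventually_mono[OF ev[of 0]]) auto
    then show "((\<lambda>g. g (A \<times> UNIV)) \<longlongrightarrow> measure \<mu> A) G"
      by (rule Lim_transform_eventually[OF tendsto_const])
  qed
  have marg2: "m (UNIV \<times> B) = measure \<nu> B" if B: "B \<in> sets borel" for B
  proof (rule tendsto_unique[OF G m])
    have "measure (\<theta>s n) (UNIV \<times> B) = measure \<nu> B" for n
    proof -
      have "measure (distr (\<theta>s n) borel snd) B = measure (\<theta>s n) (snd -` B \<inter> space (\<theta>s n))"
        using B by (intro measure_distr)
          (auto simp: measurable_cong_sets[OF sets_s refl] borel_prod[symmetric])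
      also have "snd -` B \<inter> space (\<theta>s n) = UNIV \<times> B" by (auto simp: space_s)
      finally show ?thesis by (simp add: snd_s)
    qed
    then have "eventually (\<lambda>g. measure \<nu> B = g (UNIV \<times> B)) G"
      by (intro eventually_mono[OF ev[of 0]]) auto
    then show "((\<lambda>g. g (UNIV \<times> B)) \<longlongrightarrow> measure \<nu> B) G"
      by (rule Lim_transform_eventually[OF tendsto_const])
  qed
  have fin: "finite_measure \<mu>" "finite_measure \<nu>"
    using prob by (auto simp: prob_space_def)
  obtain \<theta> where sets_\<theta>: "sets \<theta> = sets borel"
    and \<theta>: "\<And>A B. A \<in> sets borel \<Longrightarrow> B \<in> sets borel \<Longrightarrow> emeasure \<theta> (A \<times> B) = ennreal (m (A \<times> B))"
    using finitely_additive_coupling_extends[OF fin(1) sets_mu fin(2) sets_nu nonneg add marg1 marg2]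
    by blast
  have space_\<theta>: "space \<theta> = UNIV"
    using sets_eq_imp_space_eq[OF sets_\<theta>] by simp
  have "distr \<theta> borel fst = \<mu>"
  proof (rule measure_eqI)
    fix A assume "A \<in> sets (distr \<theta> borel fst)"
    then have A: "A \<in> sets borel" by simp
    have "emeasure (distr \<theta> borel fst) A = emeasure \<theta> (fst -` A \<inter> space \<theta>)"
      using A by (intro emeasure_distr)
        (auto simp: measurable_cong_sets[OF sets_\<theta> refl] borel_prod[symmetric])
    also have "fst -` A \<inter> space \<theta> = A \<times> UNIV" by (auto simp: space_\<theta>)
    finally show "emeasure (distr \<theta> borel fst) A = emeasure \<mu> A"
      using A by (simp add: \<theta> marg1 finite_measure.emeasure_eq_measure[OF fin(1)])
  qed (simp add: sets_mu)
  moreover have "distr \<theta> borel snd = \<nu>"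
  proof (rule measure_eqI)
    fix B assume "B \<in> sets (distr \<theta> borel snd)"
    then have B: "B \<in> sets borel" by simp
    have "emeasure (distr \<theta> borel snd) B = emeasure \<theta> (snd -` B \<inter> space \<theta>)"
      using B by (intro emeasure_distr)
        (auto simp: measurable_cong_sets[OF sets_\<theta> refl] borel_prod[symmetric])
    also have "snd -` B \<inter> space \<theta> = UNIV \<times> B" by (auto simp: space_\<theta>)
    finally show "emeasure (distr \<theta> borel snd) B = emeasure \<nu> B"
      using B by (simp add: \<theta> marg2 finite_measure.emeasure_eq_measure[OF fin(2)])
  qed (simp add: sets_nu)
  moreover have "prob_space \<theta>"
  proof
    have "measure \<mu> UNIV = 1"
      using prob_space.prob_space[OF prob(1)] sets_eq_imp_space_eq[OF sets_mu] by simp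
    then show "emeasure \<theta> (space \<theta>) = 1"
      using \<theta>[of UNIV UNIV] marg1[of UNIV] by (simp add: space_\<theta>)
  qed
  ultimately have Cpl: "\<theta> \<in> Cpl \<mu> \<nu>"
    by (simp add: Cpl_def borel_probs_def sets_\<theta>)

  obtain D :: "nat \<Rightarrow> 'a" where D: "\<And>x e. e > 0 \<Longrightarrow> \<exists>i. dist x (D i) < e"
    using dense_sequence by blast
  \<comment> \<open>\<open>\<phi> n\<close> sorts the points into countably many Borel cells of
    radius at most 1/(n+1). Replacing two points by the centres of their cells changes the distance
    by at most 2/(n+1); subtracting this keeps \<open>h\<close> below the cost, and
    \<open>max 0\<close> keeps the base of the power nonnegative.\<close>
  define \<phi> where "\<phi> n x = (LEAST i. dist x (D i) < 1 / real (Suc n))" for n x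
  define h where "h n i j = max 0 (dist (D i) (D j) - 2 / real (Suc n)) powr p" for n i j
  define g where "g n N z = (\<Sum>i<N. \<Sum>j<N. ennreal (h n i j) *
    indicator ((\<phi> n -` {i}) \<times> (\<phi> n -` {j})) z)" for n N and z :: "'a \<times> 'a"
  have \<phi>: "dist x (D (\<phi> n x)) < 1 / real (Suc n)" for n x
    unfolding \<phi>_def by (rule LeastI_ex) (simp add: D)
  have "\<phi> n \<in> measurable borel (count_space UNIV)" for n
    unfolding \<phi>_def by measurable
  from measurable_sets[OF this] have cell [measurable]: "\<phi> n -` {i} \<in> sets borel" for n i
    by simp
  have rect: "(\<phi> n -` {i}) \<times> (\<phi> n -` {j}) \<in> sets borel" for n i j
    using pair_measureI[OF cell cell] unfolding borel_prod .
  have h_le: "h n (\<phi> n x) (\<phi> n y) \<le> dist x y powr p" for n x y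
  proof -
    have "dist (D (\<phi> n x)) (D (\<phi> n y)) \<le> dist x y + 2 / real (Suc n)"
      using \<phi>[of x n] \<phi>[of y n] dist_triangle[of "D (\<phi> n x)" "D (\<phi> n y)" x]
        dist_triangle[of x "D (\<phi> n y)" y] by (simp add: dist_commute)
    then show ?thesis
      unfolding h_def using p by (intro powr_mono2) auto
  qed
  have g_eq: "g n N (x, y) = (if \<phi> n x < N \<and> \<phi> n y < N then ennreal (h n (\<phi> n x) (\<phi> n y)) else 0)"
    for n N x y
    unfolding g_def by (rule sum_indicator_cells)
  have g_le: "g n N z \<le> c z" for n N z
    using h_le by (cases z) (auto simp: g_eq c_def intro: ennreal_leI)
  have int_g: "(\<integral>\<^sup>+z. g n N z \<partial>M) = (\<Sum>i<N. \<Sum>j<N. ennreal (h n i j) *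
      emeasure M ((\<phi> n -` {i}) \<times> (\<phi> n -` {j})))" if "sets M = sets borel" for n N M
  proof -
    have meas: "(\<lambda>z. ennreal (h n i j) * indicator ((\<phi> n -` {i}) \<times> (\<phi> n -` {j})) z) \<in> borel_measurable M"
      for i j
      using rect[of n i j] that by (intro borel_measurable_times_ennreal borel_measurable_indicator) auto
    have "(\<integral>\<^sup>+z. g n N z \<partial>M) = (\<Sum>i<N. \<integral>\<^sup>+z. (\<Sum>j<N. ennreal (h n i j) *
        indicator ((\<phi> n -` {i}) \<times> (\<phi> n -` {j})) z) \<partial>M)"
      unfolding g_def by (intro nn_integral_sum borel_measurable_sum meas)
    also have "\<dots> = (\<Sum>i<N. \<Sum>j<N. \<integral>\<^sup>+z. ennreal (h n i j) *
        indicator ((\<phi> n -` {i}) \<times> (\<phi> n -` {j})) z \<partial>M)"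
      by (intro sum.cong refl nn_integral_sum meas)
    also have "\<dots> = (\<Sum>i<N. \<Sum>j<N. ennreal (h n i j) * emeasure M ((\<phi> n -` {i}) \<times> (\<phi> n -` {j})))"
      using rect that by (intro sum.cong refl nn_integral_cmult_indicator) auto
    finally show ?thesis .
  qed
  \<comment> \<open>The integral is a finite linear combination of values on rectangles, hence
    continuous along \<open>G\<close>. On the tail \<open>k \<ge> K\<close> it is at most
    \<open>f K\<close>, because \<open>f\<close> is decreasing.\<close>
  have "(\<integral>\<^sup>+z. g n N z \<partial>\<theta>) \<le> f K" for n N K
  proof -
    let ?s = "\<lambda>u :: ('a \<times> 'a) set \<Rightarrow> real. \<Sum>i<N. \<Sum>j<N. h n i j * u ((\<phi> n -` {i}) \<times> (\<phi> n -` {j}))"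
    have h_nonneg: "h n i j \<ge> 0" for i j by (simp add: h_def)
    have s: "ennreal (?s u) = (\<Sum>i<N. \<Sum>j<N. ennreal (h n i j) * ennreal (u ((\<phi> n -` {i}) \<times> (\<phi> n -` {j}))))"
      if "\<And>S. u S \<ge> 0" for u
    proof -
      have "(\<Sum>i<N. \<Sum>j<N. ennreal (h n i j) * ennreal (u ((\<phi> n -` {i}) \<times> (\<phi> n -` {j})))) =
          (\<Sum>i<N. \<Sum>j<N. ennreal (h n i j * u ((\<phi> n -` {i}) \<times> (\<phi> n -` {j}))))"
        using that h_nonneg by (simp add: ennreal_mult)
      also have "\<dots> = (\<Sum>i<N. ennreal (\<Sum>j<N. h n i j * u ((\<phi> n -` {i}) \<times> (\<phi> n -` {j}))))"
        using that h_nonneg by (intro sum.cong refl sum_ennreal mult_nonneg_nonneg)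
      also have "\<dots> = ennreal (?s u)"
        using that h_nonneg by (intro sum_ennreal sum_nonneg mult_nonneg_nonneg)
      finally show ?thesis by simp
    qed
    have "((\<lambda>u. ennreal (?s u)) \<longlongrightarrow> ennreal (?s m)) G"
      by (intro tendsto_ennrealI tendsto_sum tendsto_mult tendsto_const m)
    moreover have "eventually (\<lambda>u. ennreal (?s u) \<le> f K) G"
    proof (rule eventually_mono[OF ev[of K]], elim exE conjE)
      fix u k assume "k \<ge> K" and u: "u = measure (\<theta>s k)"
      interpret prob_space "\<theta>s k" by (rule prob_s)
      have "ennreal (?s u) = (\<integral>\<^sup>+z. g n N z \<partial>\<theta>s k)"
        unfolding u by (subst s) (simp_all add: int_g sets_s emeasure_eq_measure)
      also have "\<dots> \<le> transport_cost p (\<theta>s k)"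
        unfolding cost by (intro nn_integral_mono g_le)
      also have "\<dots> \<le> f K"
        unfolding \<theta>s using f(1) \<open>k \<ge> K\<close> by (rule decseqD)
      finally show "ennreal (?s u) \<le> f K" .
    qed
    ultimately have "ennreal (?s m) \<le> f K"
      using tendsto_upperbound G by blast
    then show ?thesis
      unfolding s[of m, OF nonneg] int_g[OF sets_\<theta>] \<theta>[OF cell cell] .
  qed
  then have g_W: "(\<integral>\<^sup>+z. g n N z \<partial>\<theta>) \<le> (INF i. f i)" for n N
    by (intro INF_greatest)
  have g_meas: "g n N \<in> borel_measurable \<theta>" for n N
    unfolding g_def measurable_cong_sets[OF sets_\<theta> refl]
    by (intro borel_measurable_sum borel_measurable_times_ennreal borel_measurable_indicator rect) auto
  have g_lim: "(\<lambda>N. g n N z) \<longlonglongrightarrow> ennreal (h n (\<phi> n (fst z)) (\<phi> n (snd z)))" for n z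
  proof -
    obtain x y where z: "z = (x, y)" by fastforce
    show ?thesis
      by (rule tendsto_eventually, rule eventually_sequentiallyI[of "Suc (max (\<phi> n x) (\<phi> n y))"])
        (auto simp: z g_eq)
  qed
  have h_W: "(\<integral>\<^sup>+z. ennreal (h n (\<phi> n (fst z)) (\<phi> n (snd z))) \<partial>\<theta>) \<le> (INF i. f i)" for n
    by (rule nn_integral_LIMSEQ_le[OF g_meas[of n] g_lim g_W])
  have "(\<integral>\<^sup>+z. c z \<partial>\<theta>) \<le> (INF i. f i)"
  proof (rule nn_integral_LIMSEQ_le[OF _ _ h_W])
    show "(\<lambda>z. ennreal (h n (\<phi> n (fst z)) (\<phi> n (snd z)))) \<in> borel_measurable \<theta>" for n
    proof (rule borel_measurable_LIMSEQ_order[OF _ g_meas])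
      fix z :: "'a \<times> 'a"
      show "(\<lambda>N. g n N z) \<longlonglongrightarrow> ennreal (h n (\<phi> n (fst z)) (\<phi> n (snd z)))"
        by (rule g_lim)
    qed
    fix z :: "'a \<times> 'a"
    obtain x y where z: "z = (x, y)" by fastforce
    \<comment> \<open>The centres already cost 2/(n+1) and the definition of \<open>h\<close>
      subtracts another 2/(n+1), whence 4/(n+1) in the lower bound.\<close>
    have "(\<lambda>n. max 0 (dist (D (\<phi> n x)) (D (\<phi> n y)) - 2 / real (Suc n))) \<longlonglongrightarrow> dist x y"
    proof (rule tendsto_sandwich)
      show "\<forall>\<^sub>F n in sequentially. dist x y - 4 / real (Suc n) \<le>
          max 0 (dist (D (\<phi> n x)) (D (\<phi> n y)) - 2 / real (Suc n))"
      proof (rule always_eventually, rule allI)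
        fix n
        have "dist x y \<le> dist (D (\<phi> n x)) (D (\<phi> n y)) + 2 / real (Suc n)"
          using \<phi>[of x n] \<phi>[of y n] dist_triangle[of x y "D (\<phi> n x)"]
            dist_triangle[of "D (\<phi> n x)" y "D (\<phi> n y)"] by (simp add: dist_commute)
        then show "dist x y - 4 / real (Suc n) \<le>
          max 0 (dist (D (\<phi> n x)) (D (\<phi> n y)) - 2 / real (Suc n))" by simp
      qed
      show "\<forall>\<^sub>F n in sequentially.
          max 0 (dist (D (\<phi> n x)) (D (\<phi> n y)) - 2 / real (Suc n)) \<le> dist x y"
      proof (rule always_eventually, rule allI)
        fix n
        show "max 0 (dist (D (\<phi> n x)) (D (\<phi> n y)) - 2 / real (Suc n)) \<le> dist x y"
          using \<phi>[of x n] \<phi>[of y n] dist_triangle[of "D (\<phi> n x)" "D (\<phi> n y)" x]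
            dist_triangle[of x "D (\<phi> n y)" y] by (simp add: dist_commute)
      qed
      have "(\<lambda>n. dist x y - 4 * (1 / real (Suc n))) \<longlonglongrightarrow> dist x y - 4 * 0"
        by (intro tendsto_intros LIMSEQ_inverse_real_of_nat[unfolded inverse_eq_divide])
      then show "(\<lambda>n. dist x y - 4 / real (Suc n)) \<longlonglongrightarrow> dist x y" by simp
    qed simp
    then have "(\<lambda>n. h n (\<phi> n x) (\<phi> n y)) \<longlonglongrightarrow> dist x y powr p"
      unfolding h_def using p by (intro tendsto_powr' tendsto_const) auto
    then show "(\<lambda>n. ennreal (h n (\<phi> n (fst z)) (\<phi> n (snd z)))) \<longlonglongrightarrow> c z"
      by (simp add: z c_def tendsto_ennrealI)
  qed
  then have "transport_cost p \<theta> \<le> transport_cost p \<theta>'" if "\<theta>' \<in> Cpl \<mu> \<nu>" for \<theta>'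
    unfolding cost[of \<theta>] f(3)[symmetric] using INF_lower[OF that] by (rule order_trans)
  then have "\<theta> \<in> OptCpl p \<mu> \<nu>"
    using Cpl by (auto simp: OptCpl_def is_arg_min_def not_less)
  then show thesis by (rule that)
qed

section \<open>Borel sections\<close>

text \<open>The fibre over \<open>y\<close> is cut at stage n by the first ball of radius 1/(n+1)
  that meets what is left of it. The nested compact sets \<open>F y n\<close> shrink to a single
  point, the limit of the ball centres. Measurability rests on compactness: \<open>K\<close> cut by
  a closed set has a compact image, and which balls are hit is decided by such images and countable
  set operations.\<close>

lemma borel_section_compact:
  fixes e :: "'x::metric_space \<Rightarrow> 'y::t2_space" and D :: "nat \<Rightarrow> 'x"
  assumes K: "compact K" and e: "continuous_on K e"
    and D: "\<And>x \<epsilon>. x \<in> K \<Longrightarrow> \<epsilon> > 0 \<Longrightarrow> \<exists>i. dist x (D i) < \<epsilon>"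
  obtains s where "s \<in> borel_measurable borel" and "\<And>y. y \<in> e ` K \<Longrightarrow> s y \<in> K \<and> e (s y) = y"
proof -
  define C where "C n i = cball (D i) (1 / real (Suc n))" for n i
  define F where "F y = rec_nat (K \<inter> e -` {y}) (\<lambda>n Z. Z \<inter> C n (LEAST i. Z \<inter> C n i \<noteq> {}))" for y
  define I where "I y n = (LEAST i. F y n \<inter> C n i \<noteq> {})" for y n
  have F_0: "F y 0 = K \<inter> e -` {y}" and F_Suc: "F y (Suc n) = F y n \<inter> C n (I y n)" for y n
    by (simp_all add: F_def I_def)
  have F_K: "F y n \<subseteq> K" for y n
    by (induction n) (auto simp: F_0 F_Suc)
  have ex: "\<exists>i. F y n \<inter> C n i \<noteq> {}" if ne: "F y n \<noteq> {}" for y n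
  proof -
    obtain x where x: "x \<in> F y n" using ne by blast
    then obtain i where "dist x (D i) < 1 / real (Suc n)"
      using F_K D[of x "1 / real (Suc n)"] by auto
    with x show ?thesis by (auto simp: C_def dist_commute intro!: exI[of _ i])
  qed
  \<comment> \<open>Quantifying over all closed \<open>Z\<close> lets the induction close: the next
    stage replaces \<open>Z\<close> by its intersection with a ball. That the ball is the first one
    to be hit becomes the set difference with all earlier balls.\<close>
  have meet: "{y \<in> e ` K. F y n \<inter> Z \<noteq> {}} \<in> sets borel" if "closed Z" for n Z
    using that
  proof (induction n arbitrary: Z)
    case 0
    have "{y \<in> e ` K. F y 0 \<inter> Z \<noteq> {}} = e ` (K \<inter> Z)"
    proof (intro equalityI subsetI)
      fix y assume "y \<in> {y \<in> e ` K. F y 0 \<inter> Z \<noteq> {}}"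
      then obtain x where "x \<in> K \<inter> Z" "e x = y" unfolding F_0 by blast
      then show "y \<in> e ` (K \<inter> Z)" by blast
    next
      fix y assume "y \<in> e ` (K \<inter> Z)"
      then obtain x where "x \<in> K" "x \<in> Z" "y = e x" by auto
      then show "y \<in> {y \<in> e ` K. F y 0 \<inter> Z \<noteq> {}}" by (auto simp: F_0)
    qed
    moreover have "compact (e ` (K \<inter> Z))"
      using K e 0 by (intro compact_continuous_image compact_Int_closed) (auto intro: continuous_on_subset)
    ultimately show ?case by (auto intro: borel_compact)
  next
    case (Suc n)
    have C: "closed (C n i)" for i by (simp add: C_def)
    have "{y \<in> e ` K. F y (Suc n) \<inter> Z \<noteq> {}} =
      (\<Union>i. ({y \<in> e ` K. F y n \<inter> (C n i \<inter> Z) \<noteq> {}} - (\<Union>j<i. {y \<in> e ` K. F y n \<inter> C n j \<noteq> {}})))"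
      (is "?L = ?R")
    proof
      show "?L \<subseteq> ?R"
      proof
        fix y assume y: "y \<in> ?L"
        then have "F y n \<inter> (C n (I y n) \<inter> Z) \<noteq> {}"
          by (auto simp: F_Suc)
        moreover have "F y n \<inter> C n j = {}" if "j < I y n" for j
          using not_less_Least that unfolding I_def by blast
        ultimately show "y \<in> ?R" using y by auto
      qed
      show "?R \<subseteq> ?L"
      proof
        fix y assume "y \<in> ?R"
        then obtain i where i: "y \<in> e ` K" "F y n \<inter> (C n i \<inter> Z) \<noteq> {}"
          "\<And>j. j < i \<Longrightarrow> F y n \<inter> C n j = {}" by auto
        have "I y n = i"
          unfolding I_def
        proof (rule Least_equality)
          show "F y n \<inter> C n i \<noteq> {}" using i(2) by blast
        qed (metis i(3) not_le)
        then show "y \<in> ?L" using i by (auto simp: F_Suc)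
      qed
    qed
    also have "\<dots> \<in> sets borel"
      using Suc C by (intro sets.countable_UN sets.Diff sets.finite_UN) (auto intro!: Suc.IH closed_Int)
    finally show ?case .
  qed
  have eK: "e ` K \<in> sets borel"
    using compact_continuous_image[OF e K] by (rule borel_compact)
  \<comment> \<open>The centres may lie outside \<open>K\<close>; only their limit is in the fibre.
    Off the image, the constant \<open>D 0\<close> makes the sequence measurable and convergent
    everywhere.\<close>
  define t where "t n y = (if y \<in> e ` K then D (I y n) else D 0)" for n y
  have t_meas: "t n \<in> borel_measurable borel" for n
  proof -
    have "(\<lambda>y. I y n) \<in> measurable (restrict_space borel (e ` K)) (count_space UNIV)"
      unfolding I_def
    proof (rule measurable_Least)
      fix i
      have "{y \<in> e ` K. F y n \<inter> C n i \<noteq> {}} \<in> sets borel"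
        by (rule meet) (simp add: C_def)
      then show "Measurable.pred (restrict_space borel (e ` K)) (\<lambda>y. F y n \<inter> C n i \<noteq> {})"
        using eK by (simp add: pred_def space_restrict_space sets_restrict_space_iff)
    qed
    then have "(\<lambda>y. D (I y n)) \<in> measurable (restrict_space borel (e ` K)) borel"
      by (rule measurable_compose) simp
    then show ?thesis
      unfolding t_def using eK by (intro measurable_If_restrict_space_iff[THEN iffD2]) auto
  qed
  have lim: "\<exists>z. (\<lambda>n. t n y) \<longlonglongrightarrow> z \<and> (y \<in> e ` K \<longrightarrow> z \<in> K \<and> e z = y)" for y
  proof (cases "y \<in> e ` K")
    case False
    then show ?thesis by (auto simp: t_def intro!: exI[of _ "D 0"])
  next
    case True
    have ne: "F y n \<noteq> {}" for n
    proof (induction n)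
      case 0
      then show ?case using True by (auto simp: F_0)
    next
      case (Suc n)
      then show ?case
        unfolding F_Suc I_def by (rule LeastI_ex[OF ex])
    qed
    have cpt: "compact (F y n)" for n
    proof (induction n)
      case 0
      have "closedin (top_of_set K) (K \<inter> e -` {y})"
        by (rule continuous_closedin_preimage[OF e]) simp
      then show ?case
        unfolding F_0 using K by (rule closedin_compact[rotated])
    next
      case (Suc n)
      then show ?case by (auto simp: F_Suc C_def)
    qed
    have anti: "F y n \<subseteq> F y m" if "m \<le> n" for m n
      using that by (rule lift_Suc_antimono_le[rotated]) (auto simp: F_Suc)
    have "F y 0 \<inter> (\<Inter>n\<in>UNIV. F y n) \<noteq> {}"
    proof (rule compact_imp_fip_image[OF cpt])
      show "closed (F y n)" for n
        using cpt by (rule compact_imp_closed)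
      fix J :: "nat set" assume "finite J"
      \<comment> \<open>Inserting 0 keeps \<open>Max\<close> meaningful for empty
        \<open>J\<close>.\<close>
      then have "F y (Max (insert 0 J)) \<subseteq> F y 0 \<inter> (\<Inter>n\<in>J. F y n)"
        by (intro Int_greatest INT_greatest anti) auto
      then show "F y 0 \<inter> (\<Inter>n\<in>J. F y n) \<noteq> {}"
        using ne by blast
    qed
    then obtain z where z: "\<And>n. z \<in> F y n" by auto
    have "dist (t n y) z \<le> 1 / real (Suc n)" for n
      using z[of "Suc n"] True by (simp add: F_Suc t_def C_def)
    then have "(\<lambda>n. dist (t n y) z) \<longlonglongrightarrow> 0"
      by (intro tendsto_sandwich[OF _ _ tendsto_const LIMSEQ_inverse_real_of_nat])
        (auto simp: inverse_eq_divide)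
    then have "(\<lambda>n. t n y) \<longlonglongrightarrow> z"
      by (rule tendsto_dist_iff[THEN iffD2])
    then show ?thesis using z[of 0] by (auto simp: F_0)
  qed
  then obtain s where s: "\<And>y. (\<lambda>n. t n y) \<longlonglongrightarrow> s y" "\<And>y. y \<in> e ` K \<Longrightarrow> s y \<in> K \<and> e (s y) = y"
    by metis
  have "s \<in> borel_measurable borel"
    by (rule borel_measurable_LIMSEQ_metric[OF t_meas s(1)])
  then show thesis using s(2) by (rule that)
qed

text \<open>Choquet's capacity argument. Outer measure is continuous along increasing unions of
  arbitrary sets, so at stage n finitely many closed balls of radius 1/(n+1) suffice to keep the
  image above \<open>a\<close>. The intersection of all stages is closed and totally bounded, hence
  compact, and the closures of the images decrease to its image.\<close>

lemma outer_measure_image_compact_approx: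
  fixes e :: "'x::complete_space \<Rightarrow> 'y::metric_space" and D :: "nat \<Rightarrow> 'x"
  assumes S: "closed S" and e: "continuous_on S e"
    and D: "\<And>x \<epsilon>. x \<in> S \<Longrightarrow> \<epsilon> > 0 \<Longrightarrow> \<exists>i. dist x (D i) < \<epsilon>"
    and M: "sets M = sets borel" "finite_measure M"
    and a: "a < outer_measure_of M (e ` S)"
  obtains K where "compact K" "K \<subseteq> S" "a \<le> emeasure M (e ` K)"
proof -
  interpret finite_measure M by fact
  have space: "space M = UNIV"
    using sets_eq_imp_space_eq[OF M(1)] by simp
  define B where "B n j = (\<Union>i\<le>j. cball (D i) (1 / real (Suc n)))" for n j :: nat
  have step: "\<exists>j. a < outer_measure_of M (e ` (T \<inter> B n j))"
    if "T \<subseteq> S" "a < outer_measure_of M (e ` T)" for T n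
  proof -
    have "incseq (\<lambda>j. e ` (T \<inter> B n j))"
      unfolding incseq_def B_def by (intro allI impI image_mono Int_mono UN_mono) auto
    then have "(SUP j. outer_measure_of M (e ` (T \<inter> B n j))) = outer_measure_of M (\<Union>j. e ` (T \<inter> B n j))"
      by (intro SUP_outer_measure_of_incseq) (auto simp: space)
    also have "(\<Union>j. e ` (T \<inter> B n j)) = e ` T"
    proof -
      have "T \<subseteq> (\<Union>j. B n j)"
      proof
        fix x assume "x \<in> T"
        then obtain i where "dist x (D i) < 1 / real (Suc n)"
          using \<open>T \<subseteq> S\<close> D[of x "1 / real (Suc n)"] by auto
        then show "x \<in> (\<Union>j. B n j)"
          by (auto simp: B_def dist_commute intro!: exI[of _ i] bexI[of _ i])
      qed
      then show ?thesis by blast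
    qed
    finally show ?thesis
      using that(2) by (auto simp: less_SUP_iff dest!: sym[of _ "outer_measure_of M (e ` T)"])
  qed
  have "\<exists>T. \<forall>n. (T n \<subseteq> S \<and> closed (T n) \<and> a < outer_measure_of M (e ` T n)) \<and>
      (\<exists>j. T (Suc n) = T n \<inter> B n j)"
  proof (rule dependent_nat_choice)
    show "\<exists>T. T \<subseteq> S \<and> closed T \<and> a < outer_measure_of M (e ` T)"
      using S a by blast
    fix T n assume T: "T \<subseteq> S \<and> closed T \<and> a < outer_measure_of M (e ` T)"
    then obtain j where "a < outer_measure_of M (e ` (T \<inter> B n j))"
      using step by blast
    moreover have "closed (B n j)"
      unfolding B_def by (intro closed_UN) auto
    ultimately show "\<exists>T'. (T' \<subseteq> S \<and> closed T' \<and> a < outer_measure_of M (e ` T')) \<and> (\<exists>j. T' = T \<inter> B n j)"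
      using T by (intro exI[of _ "T \<inter> B n j"]) auto
  qed
  then obtain T where T: "\<And>n. T n \<subseteq> S" "\<And>n. closed (T n)" "\<And>n. a < outer_measure_of M (e ` T n)"
    and T_Suc: "\<And>n. \<exists>j. T (Suc n) = T n \<inter> B n j"
    by blast
  obtain j where j: "\<And>n. T (Suc n) = T n \<inter> B n (j n)"
    using T_Suc by metis
  have decT: "T n \<subseteq> T m" if "m \<le> n" for m n
    using that by (rule lift_Suc_antimono_le[rotated]) (auto simp: j)
  define K where "K = (\<Inter>n. T n)"
  text \<open>A sequence \<open>x n \<in> T n\<close> is totally bounded, since its tails lie in finitely many small balls.\<close>
  have conv: "\<exists>l r. l \<in> K \<and> strict_mono (r :: nat \<Rightarrow> nat) \<and> (x \<circ> r) \<longlonglongrightarrow> l" if x: "\<And>n. x n \<in> T n" for x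
  proof -
    have "\<exists>k. finite k \<and> closure (range x) \<subseteq> (\<Union>z\<in>k. ball z \<epsilon>)" if pos: "\<epsilon> > 0" for \<epsilon> :: real
    proof -
      obtain n where n: "1 / real (Suc n) < \<epsilon>"
        using nat_approx_posE[OF pos] by blast
      \<comment> \<open>Only from index n + 1 on do the terms lie in \<open>T (Suc n)\<close>, hence
        in the balls around the points of \<open>D\<close>; the earlier ones serve as their own
        centres. The balls are closed, so they cover the closure too.\<close>
      let ?k = "x ` {..n} \<union> D ` {..j n}"
      let ?C = "(\<Union>z\<in>?k. cball z (1 / real (Suc n)))"
      have "x i \<in> ?C" for i
      proof (cases "i \<le> n")
        case False
        then have "x i \<in> B n (j n)"
          using decT[of "Suc n" i] x[of i] by (auto simp: j)
        then show ?thesis by (auto simp: B_def)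
      qed (auto intro!: bexI[of _ i])
      then have "range x \<subseteq> ?C" by blast
      then have "closure (range x) \<subseteq> ?C"
        by (rule closure_minimal) (intro closed_UN, auto)
      also have "?C \<subseteq> (\<Union>z\<in>?k. ball z \<epsilon>)"
        using n by (intro UN_mono) auto
      finally show ?thesis
        by (intro exI[of _ ?k]) auto
    qed
    then have "compact (closure (range x))"
      unfolding compact_eq_totally_bounded by (auto simp: complete_eq_closed)
    then have "seq_compact (closure (range x))"
      by (simp add: compact_eq_seq_compact_metric)
    then obtain l r where lr: "strict_mono (r :: nat \<Rightarrow> nat)" "(x \<circ> r) \<longlonglongrightarrow> l"
      unfolding seq_compact_def using closure_subset by (metis rangeI subsetD)
    have "l \<in> T n" for n
    proof (rule Lim_in_closed_set[OF T(2) _ _ lr(2)])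
      show "\<forall>\<^sub>F i in sequentially. (x \<circ> r) i \<in> T n"
      proof (rule eventually_sequentiallyI)
        fix i assume "n \<le> i"
        then have "n \<le> r i" using seq_suble[OF lr(1), of i] by linarith
        then show "(x \<circ> r) i \<in> T n" using decT x by auto
      qed
    qed simp
    then show ?thesis using lr by (auto simp: K_def)
  qed
  have "compact K"
    unfolding compact_eq_seq_compact_metric seq_compact_def
    using conv by (metis INT_iff K_def UNIV_I)
  moreover have "K \<subseteq> S" using T(1) by (auto simp: K_def)
  moreover have "a \<le> emeasure M (e ` K)"
  proof -
    \<comment> \<open>Outer measure is not continuous along decreasing sequences of arbitrary sets,
      so the passage to \<open>K\<close> goes through closures, which are measurable. Compactness
      shows that they add nothing in the limit: points \<open>x n\<close> of \<open>T n\<close>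
      whose images tend to \<open>y\<close> have a subsequence converging in
      \<open>K\<close>.\<close>
    have "(\<Inter>n. closure (e ` T n)) \<subseteq> e ` K"
    proof
      fix y assume y: "y \<in> (\<Inter>n. closure (e ` T n))"
      have "\<exists>x. x \<in> T n \<and> dist (e x) y < 1 / real (Suc n)" for n
      proof -
        have "y \<in> closure (e ` T n)" using y by blast
        then have "\<exists>z\<in>e ` T n. dist z y < 1 / real (Suc n)"
          unfolding closure_approachable by simp
        then show ?thesis by blast
      qed
      then obtain x where x: "\<And>n. x n \<in> T n" "\<And>n. dist (e (x n)) y < 1 / real (Suc n)"
        by metis
      obtain l r where l: "l \<in> K" and r: "strict_mono r" "(x \<circ> r) \<longlonglongrightarrow> l"
        using conv[OF x(1)] by blast
      have "l \<in> S" using l \<open>K \<subseteq> S\<close> by blast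
      have "(\<lambda>n. e ((x \<circ> r) n)) \<longlonglongrightarrow> e l"
        using r(2) \<open>l \<in> S\<close> by (rule continuous_on_tendsto_compose[OF e]) (use x(1) T(1) in \<open>auto intro!: always_eventually\<close>)
      moreover have "(\<lambda>n. dist (e (x n)) y) \<longlonglongrightarrow> 0"
        using x(2)[THEN less_imp_le]
        by (intro tendsto_sandwich[OF _ _ tendsto_const LIMSEQ_inverse_real_of_nat])
          (auto simp: inverse_eq_divide)
      then have "(\<lambda>n. e (x n)) \<longlonglongrightarrow> y"
        by (rule tendsto_dist_iff[THEN iffD2])
      then have "(\<lambda>n. e ((x \<circ> r) n)) \<longlonglongrightarrow> y"
        using LIMSEQ_subseq_LIMSEQ[OF _ r(1)] by (fastforce simp: o_def)
      ultimately have "e l = y" by (rule LIMSEQ_unique)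
      then show "y \<in> e ` K" using l by blast
    qed
    then have "emeasure M (\<Inter>n. closure (e ` T n)) \<le> emeasure M (e ` K)"
      using \<open>compact K\<close> e \<open>K \<subseteq> S\<close> M(1)
      by (intro emeasure_mono) (auto intro!: borel_compact compact_continuous_image intro: continuous_on_subset)
    moreover have "(INF n. emeasure M (closure (e ` T n))) = emeasure M (\<Inter>n. closure (e ` T n))"
      by (intro INF_emeasure_decseq) (auto simp: M(1) decseq_def intro!: closure_mono image_mono decT)
    moreover have "a \<le> (INF n. emeasure M (closure (e ` T n)))"
    proof (rule INF_greatest)
      fix n
      have "a \<le> outer_measure_of M (e ` T n)" using T(3)[of n] by simp
      also have "\<dots> \<le> outer_measure_of M (closure (e ` T n))"
        by (intro outer_measure_of_mono closure_subset)
      also have "\<dots> = emeasure M (closure (e ` T n))"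
        by (intro outer_measure_of_eq) (simp add: M(1))
      finally show "a \<le> emeasure M (closure (e ` T n))" .
    qed
    ultimately show ?thesis by simp
  qed
  ultimately show thesis by (rule that)
qed

text \<open>Surjectivity gives the image of \<open>S\<close> full outer measure, so there are
  compact \<open>K n\<close> in \<open>S\<close> whose images have mass at least 1 - 1/(n+1). Their
  sections are glued by using, at \<open>y\<close>, the first n whose image contains
  \<open>y\<close>; the complement of all these images is a null set.\<close>

lemma AE_borel_section:
  fixes e :: "'x::complete_space \<Rightarrow> 'y::metric_space" and D :: "nat \<Rightarrow> 'x"
  assumes S: "closed S" and e: "continuous_on S e" and surj: "e ` S = UNIV"
    and D: "\<And>x \<epsilon>. x \<in> S \<Longrightarrow> \<epsilon> > 0 \<Longrightarrow> \<exists>i. dist x (D i) < \<epsilon>"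
    and M: "sets M = sets borel" "prob_space M"
  obtains s where "s \<in> borel_measurable borel" and "AE y in M. s y \<in> S \<and> e (s y) = y"
proof -
  interpret prob_space M by fact
  have space: "space M = UNIV"
    using sets_eq_imp_space_eq[OF M(1)] by simp
  have "\<exists>K. compact K \<and> K \<subseteq> S \<and> ennreal (1 - 1 / real (Suc n)) \<le> emeasure M (e ` K)" for n
  proof -
    have "outer_measure_of M (e ` S) = 1"
      using emeasure_space_1 by (simp add: surj space M(1))
    then have "ennreal (1 - 1 / real (Suc n)) < outer_measure_of M (e ` S)"
      by (simp add: ennreal_less_one_iff)
    then show ?thesis
      using outer_measure_image_compact_approx[OF S e D M(1)] finite_measure_axioms by metis
  qed
  then obtain K where K: "\<And>n. compact (K n)" "\<And>n. K n \<subseteq> S"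
    "\<And>n. ennreal (1 - 1 / real (Suc n)) \<le> emeasure M (e ` K n)"
    by metis
  have eK: "continuous_on (K n) e" for n
    using e K(2) by (rule continuous_on_subset)
  have eK_sets [measurable]: "e ` K n \<in> sets borel" for n
    by (intro borel_compact compact_continuous_image eK K)
  have "\<exists>s. s \<in> borel_measurable borel \<and> (\<forall>y\<in>e ` K n. s y \<in> K n \<and> e (s y) = y)" for n
  proof -
    have "\<exists>i. dist x (D i) < \<epsilon>" if "x \<in> K n" "\<epsilon> > 0" for x and \<epsilon> :: real
      using that K(2) by (intro D) auto
    then show ?thesis
      by (rule borel_section_compact[OF K(1) eK]) auto
  qed
  then obtain s where s: "\<And>n. s n \<in> borel_measurable borel"
    "\<And>n y. y \<in> e ` K n \<Longrightarrow> s n y \<in> K n \<and> e (s n y) = y"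
    by metis
  define N where "N y = (LEAST n. y \<in> e ` K n)" for y
  have N: "N \<in> measurable borel (count_space UNIV)"
    unfolding N_def by measurable
  have "prob (\<Union>n. e ` K n) \<ge> 1"
  proof (rule LIMSEQ_le_const2)
    show "(\<lambda>n. 1 - 1 / real (Suc n)) \<longlonglongrightarrow> 1"
      using tendsto_diff[OF tendsto_const LIMSEQ_inverse_real_of_nat, of "1 :: real"]
      by (simp add: inverse_eq_divide)
    show "\<exists>N. \<forall>n\<ge>N. 1 - 1 / real (Suc n) \<le> prob (\<Union>n. e ` K n)"
    proof (intro exI allI impI)
      fix n
      have "1 - 1 / real (Suc n) \<le> prob (e ` K n)"
        using K(3)[of n] by (simp add: emeasure_eq_measure ennreal_le_iff)
      also have "\<dots> \<le> prob (\<Union>n. e ` K n)"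
        using eK_sets by (intro finite_measure_mono) (auto simp: M(1))
      finally show "1 - 1 / real (Suc n) \<le> prob (\<Union>n. e ` K n)" .
    qed
  qed
  then have "prob (\<Union>n. e ` K n) = 1"
    using prob_le_1 by (rule antisym[rotated])
  then have "AE y in M. y \<in> (\<Union>n. e ` K n)"
    using eK_sets by (intro AE_prob_1) auto
  then have "AE y in M. s (N y) y \<in> S \<and> e (s (N y) y) = y"
  proof (rule AE_mp, intro AE_I2 impI)
    fix y assume "y \<in> (\<Union>n. e ` K n)"
    then obtain n where "y \<in> e ` K n" by blast
    then have "y \<in> e ` K (N y)"
      unfolding N_def by (rule LeastI)
    then show "s (N y) y \<in> S \<and> e (s (N y) y) = y"
      using s(2) K(2) by blast
  qed
  moreover have "(\<lambda>y. s (N y) y) \<in> borel_measurable borel"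
    by (rule measurable_compose_countable[OF s(1) N])
  ultimately show thesis by (intro that)
qed

section \<open>Dyadic increments and geodesics\<close>

text \<open>Strict convexity: by the mean value theorem the slope of the chord is a derivative at an
  intermediate point, and the derivative is strictly increasing. Strictness is what later decides
  the equality case. The cases \<open>c = 0\<close> and \<open>x = 0\<close> are separate because
  the derivative is used at positive points only.\<close>

lemma powr_tangent_line_less:
  fixes x c p :: real
  assumes p: "1 < p" and "0 \<le> x" "0 \<le> c" "x \<noteq> c"
  shows "c powr p + p * c powr (p - 1) * (x - c) < x powr p"
proof -
  have deriv: "((\<lambda>x. x powr p) has_real_derivative p * z powr (p - 1)) (at z)" if "z > 0" for z :: real
    using that by (rule has_real_derivative_powr)
  consider "c = 0" | "x = 0" "c > 0" | "0 < x" "x < c" | "0 < c" "c < x"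
    using assms by linarith
  then show ?thesis
  proof cases
    case 1
    then show ?thesis using assms by simp
  next
    case 2
    then have "c powr (p - 1) * c = c powr p"
      using powr_mult_base[of c "p - 1"] by (simp add: mult.commute)
    then have "c powr p + p * c powr (p - 1) * (0 - c) = (1 - p) * c powr p"
      by (simp add: algebra_simps)
    also have "\<dots> < 0" using 2 p by (intro mult_neg_pos) auto
    finally show ?thesis using 2 by simp
  next
    case 3
    obtain z where z: "x < z" "z < c" "c powr p - x powr p = (c - x) * (p * z powr (p - 1))"
      using MVT2[of x c "\<lambda>x. x powr p" "\<lambda>z. p * z powr (p - 1)"] deriv 3 by force
    have "p * z powr (p - 1) < p * c powr (p - 1)"
      using z 3 p by (intro mult_strict_left_mono powr_less_mono2) auto
    then have "(c - x) * (p * z powr (p - 1)) < (c - x) * (p * c powr (p - 1))"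
      by (rule mult_strict_left_mono) (use 3 in simp)
    with z show ?thesis by (simp add: algebra_simps)
  next
    case 4
    obtain z where z: "c < z" "z < x" "x powr p - c powr p = (x - c) * (p * z powr (p - 1))"
      using MVT2[of c x "\<lambda>x. x powr p" "\<lambda>z. p * z powr (p - 1)"] deriv 4 by force
    have "p * c powr (p - 1) < p * z powr (p - 1)"
      using z 4 p by (intro mult_strict_left_mono powr_less_mono2) auto
    then have "(x - c) * (p * c powr (p - 1)) < (x - c) * (p * z powr (p - 1))"
      by (rule mult_strict_left_mono) (use 4 in simp)
    with z show ?thesis by (simp add: algebra_simps)
  qed
qed

text \<open>Jensen's inequality, by summing the tangent-line gaps \<open>g k\<close> at
  \<open>c = L / N\<close>. Here \<open>L\<close> is only a lower bound for the sum, as an endpoint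
  distance is for the length of a chain; the excess enters multiplied by the nonnegative slope. In
  the equality case every gap vanishes.\<close>

lemma power_mean:
  fixes a :: "nat \<Rightarrow> real" and p L :: real
  assumes p: "1 < p" and a: "\<And>k. 0 \<le> a k" and L: "0 \<le> L" "L \<le> (\<Sum>k<N. a k)" and N: "N > 0"
  shows power_mean_le: "real N * (L / real N) powr p \<le> (\<Sum>k<N. a k powr p)"
    and power_mean_eqD: "(\<Sum>k<N. a k powr p) = real N * (L / real N) powr p \<Longrightarrow> k < N \<Longrightarrow> a k = L / real N"
proof -
  define c where "c = L / real N"
  have c: "c \<ge> 0" "real N * c = L" using L N by (auto simp: c_def)
  define g where "g k = a k powr p - (c powr p + p * c powr (p - 1) * (a k - c))" for k
  have g: "g k \<ge> 0" "g k = 0 \<Longrightarrow> a k = c" for k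
    using powr_tangent_line_less[OF p a[of k] c(1)] by (cases "a k = c"; force simp: g_def)+
  have "(\<Sum>k<N. g k) = (\<Sum>k<N. a k powr p) - (real N * c powr p + p * c powr (p - 1) * ((\<Sum>k<N. a k) - L))"
    by (simp add: g_def sum_subtractf sum.distrib c(2)[symmetric] flip: sum_distrib_left)
  moreover have "p * c powr (p - 1) * ((\<Sum>k<N. a k) - L) \<ge> 0"
    using p L by simp
  ultimately have le: "(\<Sum>k<N. g k) \<le> (\<Sum>k<N. a k powr p) - real N * c powr p"
    by linarith
  moreover have "0 \<le> (\<Sum>k<N. g k)" using g by (intro sum_nonneg)
  ultimately show "real N * (L / real N) powr p \<le> (\<Sum>k<N. a k powr p)"
    by (simp add: c_def)
  assume "(\<Sum>k<N. a k powr p) = real N * (L / real N) powr p" "k < N"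
  then have "(\<Sum>k<N. g k) \<le> 0" using le by (simp add: c_def)
  then have "(\<Sum>k<N. g k) = 0" using \<open>0 \<le> (\<Sum>k<N. g k)\<close> by simp
  then have "g k = 0" using g(1) \<open>k < N\<close> by (simp add: sum_nonneg_eq_0_iff)
  then show "a k = L / real N" using g(2) by (simp add: c_def)
qed

lemma dist_le_sum_dist:
  fixes x :: "nat \<Rightarrow> 'a::metric_space"
  assumes "i \<le> j"
  shows "dist (x i) (x j) \<le> (\<Sum>k=i..<j. dist (x k) (x (Suc k)))"
  using assms
proof (induction j rule: dec_induct)
  case (step j)
  then show ?case
    using dist_triangle[of "x i" "x (Suc j)" "x j"] by simp
qed simp

text \<open>The triangle inequality along the grid and continuity give only the upper bound
  \<open>(t - s) * L\<close>. It is attained because the bounds on [0,s], [s,t] and [t,1] add up to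
  \<open>L\<close>, the distance of the endpoints, so none of them can be strict.\<close>

lemma constant_speed_geodesic_if_dyadic:
  fixes c :: "real \<Rightarrow> 'a::metric_space"
  assumes c: "continuous_on {0..1} c"
    and dyadic: "\<And>m k. k < 2 ^ m \<Longrightarrow>
      dist (c (real k / 2 ^ m)) (c (real (k + 1) / 2 ^ m)) = dist (c 0) (c 1) / 2 ^ m"
  shows "constant_speed_geodesic c"
proof -
  define L where "L = dist (c 0) (c 1)"
  have grid: "dist (c (real i / 2 ^ m)) (c (real j / 2 ^ m)) \<le> (real j / 2 ^ m - real i / 2 ^ m) * L"
    if "i \<le> j" "j \<le> 2 ^ m" for i j m :: nat
  proof -
    have "dist (c (real i / 2 ^ m)) (c (real j / 2 ^ m)) \<le>
        (\<Sum>k=i..<j. dist (c (real k / 2 ^ m)) (c (real (Suc k) / 2 ^ m)))"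
      using dist_le_sum_dist[OF that(1), of "\<lambda>k. c (real k / 2 ^ m)"] .
    also have "\<dots> = (\<Sum>k=i..<j. L / 2 ^ m)"
      using that(2) dyadic by (intro sum.cong refl) (auto simp: L_def)
    also have "\<dots> = (real j / 2 ^ m - real i / 2 ^ m) * L"
      using that(1) by (simp add: of_nat_diff field_simps)
    finally show ?thesis .
  qed
  \<comment> \<open>For nonnegative \<open>t\<close>, the last grid point of level \<open>m\<close>
    not beyond \<open>t\<close>. Rounding down is monotone, so \<open>s \<le> t\<close> yields the
    order of indices that \<open>grid\<close> requires.\<close>
  define d where "d t m = real (nat \<lfloor>t * 2 ^ m\<rfloor>) / 2 ^ m" for t :: real and m :: nat
  have d_le: "nat \<lfloor>t * 2 ^ m\<rfloor> \<le> 2 ^ m" if "t \<le> 1" for t :: real and m :: nat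
  proof -
    have "\<lfloor>t * 2 ^ m\<rfloor> \<le> \<lfloor>2 ^ m :: real\<rfloor>"
      using that by (intro floor_mono) simp
    also have "\<lfloor>2 ^ m :: real\<rfloor> = 2 ^ m"
      by (metis floor_of_int of_int_numeral of_int_power)
    finally show ?thesis by (simp add: nat_le_iff)
  qed
  have d_01: "d t m \<in> {0..1}" if "t \<le> 1" for t m
  proof -
    have "real (nat \<lfloor>t * 2 ^ m\<rfloor>) \<le> real (2 ^ m)"
      using d_le[OF that] by (rule of_nat_mono)
    then show ?thesis by (simp add: d_def)
  qed
  have d_lim: "(\<lambda>m. d t m) \<longlonglongrightarrow> t" if "0 \<le> t" for t
  proof (rule tendsto_sandwich)
    have eq: "real (nat \<lfloor>t * 2 ^ m\<rfloor>) = real_of_int \<lfloor>t * 2 ^ m\<rfloor>" for m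
      using that by simp
    show "\<forall>\<^sub>F m in sequentially. t - (1 / 2) ^ m \<le> d t m"
    proof (rule always_eventually, rule allI)
      fix m
      have "t * 2 ^ m - 1 \<le> real_of_int \<lfloor>t * 2 ^ m\<rfloor>" by linarith
      then have "(t * 2 ^ m - 1) / 2 ^ m \<le> d t m"
        unfolding d_def eq by (intro divide_right_mono) auto
      then show "t - (1 / 2) ^ m \<le> d t m" by (simp add: diff_divide_distrib power_one_over)
    qed
    show "\<forall>\<^sub>F m in sequentially. d t m \<le> t"
    proof (rule always_eventually, rule allI)
      fix m
      have "d t m \<le> t * 2 ^ m / 2 ^ m"
        unfolding d_def eq by (intro divide_right_mono) auto
      then show "d t m \<le> t" by simp
    qed
    have "(\<lambda>m. t - (1 / 2) ^ m) \<longlonglongrightarrow> t - 0"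
      by (intro tendsto_intros LIMSEQ_realpow_zero) auto
    then show "(\<lambda>m. t - (1 / 2) ^ m) \<longlonglongrightarrow> t" by simp
  qed simp
  have le: "dist (c s) (c t) \<le> (t - s) * L" if st: "0 \<le> s" "s \<le> t" "t \<le> 1" for s t
  proof (rule LIMSEQ_le)
    have "(\<lambda>m. c (d u m)) \<longlonglongrightarrow> c u" if "0 \<le> u" "u \<le> 1" for u
      using that d_01 by (intro continuous_on_tendsto_compose[OF c d_lim]) auto
    then show "(\<lambda>m. dist (c (d s m)) (c (d t m))) \<longlonglongrightarrow> dist (c s) (c t)"
      using st by (intro tendsto_dist) auto
    show "(\<lambda>m. (d t m - d s m) * L) \<longlonglongrightarrow> (t - s) * L"
      using st by (intro tendsto_intros d_lim) auto
    have "dist (c (d s m)) (c (d t m)) \<le> (d t m - d s m) * L" for m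
      unfolding d_def using st d_le
      by (intro grid) (auto intro!: nat_mono floor_mono)
    then show "\<exists>N. \<forall>m\<ge>N. dist (c (d s m)) (c (d t m)) \<le> (d t m - d s m) * L"
      by blast
  qed
  have eq: "dist (c s) (c t) = (t - s) * L" if "0 \<le> s" "s \<le> t" "t \<le> 1" for s t
  proof (rule antisym[OF le[OF that]])
    have "L \<le> dist (c 0) (c s) + dist (c s) (c t) + dist (c t) (c 1)"
      unfolding L_def using dist_triangle[of "c 0" "c 1" "c s"] dist_triangle[of "c s" "c 1" "c t"] by simp
    also have "\<dots> \<le> s * L + dist (c s) (c t) + (1 - t) * L"
      using le[of 0 s] le[of t 1] that by simp
    finally show "(t - s) * L \<le> dist (c s) (c t)" by (simp add: algebra_simps)
  qed
  show ?thesis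
    unfolding constant_speed_geodesic_def
  proof (intro ballI)
    fix s t :: real assume "s \<in> {0..1}" "t \<in> {0..1}"
    then show "dist (c s) (c t) = \<bar>t - s\<bar> * dist (c 0) (c 1)"
      using eq[of s t] eq[of t s] by (cases "s \<le> t") (auto simp: L_def dist_commute)
  qed
qed

section \<open>The Besov energy of a single path\<close>

lemma enn_powr_inverse_powr:
  assumes "p > 0"
  shows "enn_powr (enn_powr x (1 / p)) p = x"
proof (cases "x = \<infinity>")
  case False
  then have "x < top" by (simp add: top.not_eq_extremum)
  then show ?thesis
    using assms False by (simp add: enn_powr_def powr_powr ennreal_enn2real)
qed (simp add: enn_powr_def)

context
  fixes \<alpha> p :: real
  assumes p: "1 < p" and \<alpha>: "0 < \<alpha>" "\<alpha> < 1"
begin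

text \<open>Along a geodesic of length L, level m consists of 2^m increments L / 2^m with weight
  2^(m (\<alpha> p - 1)), which makes L^p times the m-th power of this number.\<close>

definition level_ratio :: real where
  "level_ratio = 2 powr (- (p - \<alpha> * p))"

text \<open>Real-valued, since a level is a finite sum: infinite energy can come only from the
  series over \<open>m\<close>, and once that converges the levels can be handled by real
  subtraction.\<close>

definition besov_level :: "nat \<Rightarrow> 'a::metric_space path_space \<Rightarrow> real" where
  "besov_level m \<gamma> = 2 powr (real m * (\<alpha> * p - 1)) *
     (\<Sum>k<2 ^ m. dist (eval_at (real k / 2 ^ m) \<gamma>) (eval_at (real (k + 1) / 2 ^ m) \<gamma>) powr p)"

lemma besov_level_nonneg: "besov_level m \<gamma> \<ge> 0"
  unfolding besov_level_def by (intro mult_nonneg_nonneg sum_nonneg) auto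

lemma enn_powr_besov: "enn_powr (besov \<alpha> p \<gamma>) p = (\<Sum>m. ennreal (besov_level m \<gamma>))"
proof -
  have "ennreal (2 powr (real m * (\<alpha> * p - 1))) *
       (\<Sum>k<2 ^ m. ennreal
         (dist (eval_at (real k / 2 ^ m) \<gamma>) (eval_at (real (k + 1) / 2 ^ m) \<gamma>) powr p)) =
       ennreal (besov_level m \<gamma>)" for m
    unfolding besov_level_def by (subst sum_ennreal) (auto simp: ennreal_mult sum_nonneg)
  then show ?thesis
    unfolding besov_def using p by (simp only: enn_powr_inverse_powr)
qed

lemma level_ratio_bounds: "0 < level_ratio" "level_ratio < 1"
proof -
  have "\<alpha> * p < 1 * p"
    using p \<alpha> by (intro mult_strict_right_mono) auto
  then show "0 < level_ratio" "level_ratio < 1"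
    unfolding level_ratio_def by (auto intro: powr_less_one)
qed

text \<open>The exponents of 2 add up as m (\<alpha> p - 1) + m - m p = - m (p - \<alpha>
  p).\<close>

lemma level_scaling:
  assumes "L \<ge> 0"
  shows "2 powr (real m * (\<alpha> * p - 1)) * (real (2 ^ m) * (L / real (2 ^ m)) powr p) = level_ratio ^ m * L powr p"
proof -
  have "(L / real (2 ^ m)) powr p = L powr p / 2 powr (real m * p)"
    using assms by (simp add: powr_divide powr_powr flip: powr_realpow)
  moreover have "real (2 ^ m) = 2 powr real m"
    by (simp flip: powr_realpow)
  moreover have "level_ratio ^ m = 2 powr (real m * (\<alpha> * p - 1)) * 2 powr real m / 2 powr (real m * p)"
    by (simp add: level_ratio_def powr_realpow[symmetric] powr_powr algebra_simps flip: powr_add powr_diff)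
  ultimately show ?thesis by simp
qed

text \<open>The increments of level m form a chain joining the endpoints, so
  \<open>power_mean\<close> applies with N = 2^m and L the endpoint distance; the positive weight
  preserves the inequality and its equality case.\<close>

lemma besov_level_ge: "level_ratio ^ m * dist (eval_at 0 \<gamma>) (eval_at 1 \<gamma>) powr p \<le> besov_level m \<gamma>"
  and besov_level_eqD: "besov_level m \<gamma> = level_ratio ^ m * dist (eval_at 0 \<gamma>) (eval_at 1 \<gamma>) powr p \<Longrightarrow> k < 2 ^ m \<Longrightarrow>
    dist (eval_at (real k / 2 ^ m) \<gamma>) (eval_at (real (k + 1) / 2 ^ m) \<gamma>) =
      dist (eval_at 0 \<gamma>) (eval_at 1 \<gamma>) / 2 ^ m"
proof -
  let ?a = "\<lambda>k. dist (eval_at (real k / 2 ^ m) \<gamma>) (eval_at (real (k + 1) / 2 ^ m) \<gamma>)"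
  let ?L = "dist (eval_at 0 \<gamma>) (eval_at 1 \<gamma>)"
  have "?L \<le> (\<Sum>k<2 ^ m. ?a k)"
    using dist_le_sum_dist[of 0 "2 ^ m" "\<lambda>k. eval_at (real k / 2 ^ m) \<gamma>"]
    by (simp add: atLeast0LessThan)
  note mean = power_mean[OF p, of ?a ?L "2 ^ m", OF _ _ this]
  show "level_ratio ^ m * ?L powr p \<le> besov_level m \<gamma>"
    unfolding besov_level_def level_scaling[OF zero_le_dist, symmetric]
    using mean(1) by (intro mult_left_mono) auto
  assume "besov_level m \<gamma> = level_ratio ^ m * ?L powr p" "k < 2 ^ m"
  then have "(\<Sum>k<2 ^ m. ?a k powr p) = real (2 ^ m) * (?L / real (2 ^ m)) powr p"
    unfolding besov_level_def level_scaling[OF zero_le_dist, symmetric] by simp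
  from mean(2)[OF _ _ _ this \<open>k < 2 ^ m\<close>] show "?a k = ?L / 2 ^ m" by simp
qed

lemma besov_level_Geo:
  assumes "\<gamma> \<in> Geo"
  shows "besov_level m \<gamma> = level_ratio ^ m * dist (eval_at 0 \<gamma>) (eval_at 1 \<gamma>) powr p"
proof -
  let ?L = "dist (eval_at 0 \<gamma>) (eval_at 1 \<gamma>)"
  have "dist (eval_at (real k / 2 ^ m) \<gamma>) (eval_at (real (k + 1) / 2 ^ m) \<gamma>) = ?L / real (2 ^ m)"
    if "k < 2 ^ m" for k
  proof -
    have "Suc k \<le> 2 ^ m" using that by simp
    then have "real (Suc k) \<le> real (2 ^ m)" by (rule of_nat_mono)
    then have "real k + 1 \<le> 2 ^ m" by simp
    then have "real k / 2 ^ m \<in> {0..1}" "real (k + 1) / 2 ^ m \<in> {0..1}"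
      using that by simp_all
    then have "dist (eval_at (real k / 2 ^ m) \<gamma>) (eval_at (real (k + 1) / 2 ^ m) \<gamma>) =
        \<bar>real (k + 1) / 2 ^ m - real k / 2 ^ m\<bar> * ?L"
      using assms unfolding Geo_def constant_speed_geodesic_def by blast
    also have "real (k + 1) / 2 ^ m - real k / 2 ^ m = 1 / 2 ^ m"
      by (simp flip: diff_divide_distrib)
    finally show ?thesis by simp
  qed
  then have "besov_level m \<gamma> = 2 powr (real m * (\<alpha> * p - 1)) * (\<Sum>k<(2::nat) ^ m. (?L / real (2 ^ m)) powr p)"
    unfolding besov_level_def by (intro arg_cong2[where f = "(*)"] sum.cong refl) auto
  then show ?thesis
    using level_scaling[of ?L m] by simp
qed

lemma geometric_levels:
  "(\<Sum>m. ennreal (level_ratio ^ m * dist x y powr p)) = ennreal (dist x y powr p / (1 - level_ratio))"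
  using sums_mult2[OF geometric_sums[of level_ratio], of "dist x y powr p"] level_ratio_bounds
  by (intro suminf_ennreal_eq) auto

lemma besov_ge:
  "ennreal (dist (eval_at 0 \<gamma>) (eval_at 1 \<gamma>) powr p) \<le> ennreal (1 - level_ratio) * enn_powr (besov \<alpha> p \<gamma>) p"
proof -
  let ?L = "dist (eval_at 0 \<gamma>) (eval_at 1 \<gamma>)"
  have "ennreal (?L powr p / (1 - level_ratio)) \<le> enn_powr (besov \<alpha> p \<gamma>) p"
    unfolding geometric_levels[symmetric] enn_powr_besov
    by (intro suminf_le allI ennreal_leI besov_level_ge) auto
  then have "ennreal (1 - level_ratio) * ennreal (?L powr p / (1 - level_ratio)) \<le>
      ennreal (1 - level_ratio) * enn_powr (besov \<alpha> p \<gamma>) p"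
    by (rule mult_left_mono) simp
  then show ?thesis
    using level_ratio_bounds by (simp flip: ennreal_mult)
qed

lemma besov_Geo:
  assumes "\<gamma> \<in> Geo"
  shows "ennreal (1 - level_ratio) * enn_powr (besov \<alpha> p \<gamma>) p = ennreal (dist (eval_at 0 \<gamma>) (eval_at 1 \<gamma>) powr p)"
  using level_ratio_bounds
  by (simp add: enn_powr_besov besov_level_Geo[OF assms] geometric_levels flip: ennreal_mult)

text \<open>Each level dominates its geometric term, while the hypothesis bounds the total by the
  total of those terms. The series of nonnegative differences therefore vanishes, and every level is
  in the equality case of the power mean.\<close>

lemma besov_le_imp_Geo:
  assumes "ennreal (1 - level_ratio) * enn_powr (besov \<alpha> p \<gamma>) p \<le> ennreal (dist (eval_at 0 \<gamma>) (eval_at 1 \<gamma>) powr p)"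
  shows "\<gamma> \<in> Geo"
proof -
  let ?L = "dist (eval_at 0 \<gamma>) (eval_at 1 \<gamma>)"
  let ?f = "\<lambda>m. besov_level m \<gamma>" and ?g = "\<lambda>m. level_ratio ^ m * ?L powr p"
  have g: "?g sums (?L powr p / (1 - level_ratio))"
    using sums_mult2[OF geometric_sums[of level_ratio], of "?L powr p"] level_ratio_bounds by simp
  have "ennreal (1 - level_ratio) * (\<Sum>m. ennreal (?f m)) \<le> ennreal (?L powr p)"
    using assms by (simp only: enn_powr_besov)
  \<comment> \<open>Finiteness has to come first: the factor is positive, so an infinite energy
    would make the left-hand side infinite.\<close>
  then have "(\<Sum>m. ennreal (?f m)) \<noteq> top"
    using level_ratio_bounds by (auto simp: ennreal_mult_top top_unique)
  then have f: "summable ?f"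
    by (intro summable_suminf_not_top) (auto simp: besov_level_nonneg)
  have "ennreal ((1 - level_ratio) * (\<Sum>m. ?f m)) = ennreal (1 - level_ratio) * (\<Sum>m. ennreal (?f m))"
    using level_ratio_bounds f
    by (subst ennreal_mult) (auto simp: suminf_ennreal2 suminf_nonneg besov_level_nonneg)
  also have "\<dots> \<le> ennreal (?L powr p)"
    using assms by (simp only: enn_powr_besov)
  finally have "(1 - level_ratio) * (\<Sum>m. ?f m) \<le> ?L powr p"
    by (subst (asm) ennreal_le_iff) auto
  then have "(\<Sum>m. ?f m) \<le> suminf ?g"
    unfolding sums_unique[OF g, symmetric] using level_ratio_bounds by (simp add: pos_le_divide_eq mult.commute)
  then have "(\<Sum>m. ?f m - ?g m) \<le> 0"
    using f g by (subst suminf_diff[symmetric]) (auto simp: sums_iff)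
  moreover have "0 \<le> (\<Sum>m. ?f m - ?g m)"
    using f g by (intro suminf_nonneg summable_diff) (auto simp: sums_iff besov_level_ge)
  ultimately have "\<forall>m. ?f m - ?g m = 0"
    using f g
    by (intro suminf_eq_zero_iff[THEN iffD1] summable_diff) (auto simp: sums_iff besov_level_ge)
  then have "dist (eval_at (real k / 2 ^ m) \<gamma>) (eval_at (real (k + 1) / 2 ^ m) \<gamma>) = ?L / 2 ^ m"
    if "k < 2 ^ m" for k m
    using that by (intro besov_level_eqD) auto
  then show ?thesis
    unfolding Geo_def
    by (intro CollectI constant_speed_geodesic_if_dyadic continuous_on_eval_at)
qed

end

section \<open>Lifting couplings to geodesics\<close>

lemma dist_path_space_le:
  assumes "\<And>t. t \<in> {0..1} \<Longrightarrow> dist (eval_at t \<gamma>) (eval_at t \<eta>) \<le> b"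
  shows "dist \<gamma> \<eta> \<le> b"
  unfolding dist_path_space using assms by (intro cSUP_least) auto

text \<open>A geodesic with endpoints at distance at most M is M-Lipschitz, so its positions at
  finitely many equally spaced times fix it up to a small error. Recording these positions by
  indices of dense points sorts the geodesics into countably many small cells, and one
  representative per nonempty cell suffices.\<close>

lemma dense_sequence_Geo:
  obtains D :: "nat \<Rightarrow> 'a::polish_space path_space"
  where "\<And>\<gamma> \<epsilon>. \<gamma> \<in> Geo \<Longrightarrow> \<epsilon> > 0 \<Longrightarrow> \<exists>i. dist \<gamma> (D i) < \<epsilon>"
proof -
  obtain q :: "nat \<Rightarrow> 'a" where q: "\<And>x e. e > 0 \<Longrightarrow> \<exists>i. dist x (q i) < e"
    using dense_sequence by blast
  \<comment> \<open>With time steps 1/((n+1)(M+1)) a geodesic of speed at most M moves by at most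
    1/(n+1) within a step; M + 1 in place of M keeps the number of steps positive.\<close>
  define N where "N n M = Suc n * Suc M" for n M
  define cell :: "nat \<times> nat \<times> nat list \<Rightarrow> 'a path_space set" where
    "cell = (\<lambda>(n, M, l). {\<gamma> \<in> Geo. dist (eval_at 0 \<gamma>) (eval_at 1 \<gamma>) \<le> real M \<and>
      (\<forall>k\<le>N n M. dist (eval_at (real k / real (N n M)) \<gamma>) (q (l ! k)) < 1 / real (Suc n))})"
  \<comment> \<open>Four errors of 1/(n+1): for each of the two paths, from time t to the grid time
    before it, and from there to the common point \<open>q (l ! k)\<close>.\<close>
  have diam: "dist \<gamma> \<eta> \<le> 4 / real (Suc n)" if \<gamma>: "\<gamma> \<in> cell (n, M, l)" and \<eta>: "\<eta> \<in> cell (n, M, l)" for \<gamma> \<eta> n M l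
  proof (rule dist_path_space_le)
    fix t :: real assume t: "t \<in> {0..1}"
    have N: "real (N n M) > 0" unfolding N_def of_nat_0_less_iff by simp
    define k where "k = nat \<lfloor>t * real (N n M)\<rfloor>"
    have k: "real k = of_int \<lfloor>t * real (N n M)\<rfloor>" using t by (simp add: k_def)
    have k_le: "k \<le> N n M"
    proof -
      have "t * real (N n M) \<le> real (N n M)" using t by (simp add: mult_left_le_one_le)
      then have "real k \<le> real (N n M)" unfolding k by linarith
      then show ?thesis by simp
    qed
    have u: "real k / real (N n M) \<in> {0..1}" (is "?u \<in> _")
      using k_le N by (simp add: divide_le_eq)
    have "real k \<le> t * real (N n M)" "t * real (N n M) \<le> real k + 1" unfolding k by linarith+
    then have "?u \<le> t" "t \<le> (real k + 1) / real (N n M)"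
      using N by (simp_all only: pos_divide_le_eq pos_le_divide_eq)
    then have tu: "\<bar>t - ?u\<bar> \<le> 1 / real (N n M)"
      by (simp add: add_divide_distrib)
    have step: "dist (eval_at t \<xi>) (eval_at ?u \<xi>) \<le> 1 / real (Suc n)" if \<xi>: "\<xi> \<in> cell (n, M, l)" for \<xi>
    proof -
      have "dist (eval_at ?u \<xi>) (eval_at t \<xi>) = \<bar>t - ?u\<bar> * dist (eval_at 0 \<xi>) (eval_at 1 \<xi>)"
        using \<xi> t u unfolding cell_def Geo_def constant_speed_geodesic_def by blast
      also have "\<dots> \<le> 1 / real (N n M) * real (Suc M)"
        using \<xi> tu by (intro mult_mono) (auto simp: cell_def)
      also have "\<dots> = 1 / real (Suc n)"
        unfolding N_def of_nat_mult by (simp del: of_nat_Suc)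
      finally show ?thesis by (simp add: dist_commute)
    qed
    have "dist (eval_at ?u \<gamma>) (q (l ! k)) < 1 / real (Suc n)" "dist (eval_at ?u \<eta>) (q (l ! k)) < 1 / real (Suc n)"
      using \<gamma> \<eta> k_le by (auto simp: cell_def)
    moreover note step[OF \<gamma>] step[OF \<eta>]
    moreover have "dist (eval_at t \<gamma>) (eval_at t \<eta>) \<le> dist (eval_at t \<gamma>) (eval_at ?u \<gamma>) +
        dist (eval_at ?u \<gamma>) (q (l ! k)) + dist (eval_at ?u \<eta>) (q (l ! k)) + dist (eval_at t \<eta>) (eval_at ?u \<eta>)"
      using dist_triangle[of "eval_at t \<gamma>" "eval_at t \<eta>" "eval_at ?u \<gamma>"]
        dist_triangle[of "eval_at ?u \<gamma>" "eval_at t \<eta>" "q (l ! k)"]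
        dist_triangle[of "q (l ! k)" "eval_at t \<eta>" "eval_at ?u \<eta>"] by (simp add: dist_commute)
    ultimately show "dist (eval_at t \<gamma>) (eval_at t \<eta>) \<le> 4 / real (Suc n)" by simp
  qed
  show thesis
  \<comment> \<open>For an empty cell the choice is an arbitrary path; only cells that contain the
    given geodesic are ever used.\<close>
  proof (rule that[of "\<lambda>i. SOME \<gamma>. \<gamma> \<in> cell (from_nat i)"])
    fix \<gamma> :: "'a path_space" and \<epsilon> :: real assume \<gamma>: "\<gamma> \<in> Geo" and \<epsilon>: "\<epsilon> > 0"
    obtain n where n: "1 / real (Suc n) < \<epsilon> / 4"
    proof -
      have "\<epsilon> / 4 > 0" using \<epsilon> by simp
      then show thesis using nat_approx_posE that by blast
    qed
    obtain M where M: "dist (eval_at 0 \<gamma>) (eval_at 1 \<gamma>) \<le> real M"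
      using real_arch_simple by blast
    have "\<forall>k. \<exists>i. dist (eval_at (real k / real (N n M)) \<gamma>) (q i) < 1 / real (Suc n)"
      using q by simp
    then obtain f where f: "\<And>k. dist (eval_at (real k / real (N n M)) \<gamma>) (q (f k)) < 1 / real (Suc n)"
      by metis
    define l where "l = map f [0..<Suc (N n M)]"
    have "\<gamma> \<in> cell (n, M, l)"
      using \<gamma> M f by (auto simp: cell_def l_def nth_append simp del: upt_Suc)
    moreover from this have "(SOME \<gamma>. \<gamma> \<in> cell (n, M, l)) \<in> cell (n, M, l)"
      by (rule someI)
    ultimately have "dist \<gamma> (SOME \<gamma>. \<gamma> \<in> cell (n, M, l)) \<le> 4 / real (Suc n)"
      by (rule diam)
    also have "\<dots> < \<epsilon>" using n by simp
    finally show "\<exists>i. dist \<gamma> (SOME \<gamma>. \<gamma> \<in> cell (from_nat i)) < \<epsilon>"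
      by (intro exI[of _ "to_nat (n, M, l)"]) simp
  qed
qed

section \<open>The endpoint map\<close>

definition ends :: "'a::metric_space path_space \<Rightarrow> 'a \<times> 'a" where
  "ends \<gamma> = (eval_at 0 \<gamma>, eval_at 1 \<gamma>)"

lemma continuous_on_ends: "continuous_on A ends"
  unfolding ends_def[abs_def]
  by (rule continuous_on_subset[OF continuous_on_Pair[OF continuous_eval_at continuous_eval_at]]) simp

lemma measurable_ends [measurable]: "ends \<in> borel_measurable borel"
  by (rule borel_measurable_continuous_onI[OF continuous_on_ends])

text \<open>The geodesics supplied by \<open>geodesic_space\<close> are bare functions; constant
  speed makes them Lipschitz, hence continuous, and so restrictions of them are points of the path
  space.\<close>

lemma ends_Geo:
  assumes "geodesic_space TYPE('a::metric_space)"
  shows "ends ` (Geo :: 'a path_space set) = UNIV"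
proof -
  have "z \<in> ends ` (Geo :: 'a path_space set)" for z
  proof -
    obtain x y where z: "z = (x, y)" by fastforce
    obtain c where c: "constant_speed_geodesic c" "c 0 = x" "c 1 = y"
      using assms unfolding geodesic_space_def by blast
    define L where "L = dist (c 0) (c 1)"
    have "L-lipschitz_on {0..1} c"
    proof (rule lipschitz_onI)
      fix s t :: real assume "s \<in> {0..1}" "t \<in> {0..1}"
      then have "dist (c s) (c t) = \<bar>t - s\<bar> * L"
        using c(1) unfolding constant_speed_geodesic_def L_def by blast
      then show "dist (c s) (c t) \<le> L * dist s t"
        by (simp add: dist_real_def abs_minus_commute)
    qed (simp add: L_def)
    then have "continuous_on {0..1} c"
      by (rule lipschitz_on_continuous_on)
    then obtain \<gamma> where \<gamma>: "\<forall>t\<in>{0..1}. eval_at t \<gamma> = c t"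
      using ex_path by blast
    then have "\<gamma> \<in> Geo" "ends \<gamma> = z"
      using c by (auto simp: Geo_def constant_speed_geodesic_def ends_def z)
    then show ?thesis by blast
  qed
  then show ?thesis by blast
qed

section \<open>Transport cost and endpoint laws of plans\<close>

lemma measurable_fst_snd_borel [measurable]:
  "fst \<in> measurable (borel :: ('a::topological_space \<times> 'b::topological_space) measure) borel"
  "snd \<in> measurable (borel :: ('a::topological_space \<times> 'b::topological_space) measure) borel"
  by (intro borel_measurable_continuous_onI continuous_on_fst continuous_on_snd continuous_on_id)+

lemma measurable_cost [measurable]:
  "(\<lambda>(x, y). ennreal (dist x y powr p)) \<in> borel_measurable (borel :: ('a::metric_space \<times> 'a) measure)"
proof -
  have [measurable]: "(\<lambda>z :: 'a \<times> 'a. dist (fst z) (snd z)) \<in> borel_measurable borel"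
    by (intro borel_measurable_continuous_onI continuous_intros)
  show ?thesis
    unfolding case_prod_beta by measurable
qed

text \<open>This makes the optimal cost finite, which permits the subtraction of integrals in the
  characterization of minimizers.\<close>

lemma transport_cost_finite:
  fixes \<mu> \<nu> :: "'a::metric_space measure"
  assumes p: "p > 0" and mu: "\<mu> \<in> P_moment p" and nu: "\<nu> \<in> P_moment p" and \<theta>: "\<theta> \<in> Cpl \<mu> \<nu>"
  shows "transport_cost p \<theta> < \<infinity>"
proof -
  have sets: "sets \<theta> = sets borel" and "prob_space \<theta>"
    and marg: "distr \<theta> borel fst = \<mu>" "distr \<theta> borel snd = \<nu>"
    using \<theta> by (auto simp: Cpl_def borel_probs_def)
  interpret prob_space \<theta> by fact
  note meas = measurable_cong_sets[OF sets refl]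
  obtain x0 y0 where x0: "(\<integral>\<^sup>+ x. ennreal (dist x x0 powr p) \<partial>\<mu>) < \<infinity>"
    and y0: "(\<integral>\<^sup>+ x. ennreal (dist x y0 powr p) \<partial>\<nu>) < \<infinity>"
    using mu nu unfolding P_moment_def by blast
  have m: "(\<lambda>x :: 'a. ennreal (dist x z powr p)) \<in> borel_measurable borel" for z
  proof -
    have [measurable]: "(\<lambda>x :: 'a. dist x z) \<in> borel_measurable borel"
      by (intro borel_measurable_continuous_onI continuous_intros)
    show ?thesis by measurable
  qed
  have m1: "(\<lambda>z. ennreal (dist (fst z) x0 powr p)) \<in> borel_measurable \<theta>"
    unfolding meas by (rule measurable_compose[OF measurable_fst_snd_borel(1) m])
  have m2: "(\<lambda>z. ennreal (dist (snd z) y0 powr p)) \<in> borel_measurable \<theta>"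
    unfolding meas by (rule measurable_compose[OF measurable_fst_snd_borel(2) m])
  have i1: "(\<integral>\<^sup>+ z. ennreal (dist (fst z) x0 powr p) \<partial>\<theta>) = (\<integral>\<^sup>+ x. ennreal (dist x x0 powr p) \<partial>\<mu>)"
    unfolding marg(1)[symmetric] by (intro nn_integral_distr[symmetric]) (simp_all add: meas m)
  have i2: "(\<integral>\<^sup>+ z. ennreal (dist (snd z) y0 powr p) \<partial>\<theta>) = (\<integral>\<^sup>+ x. ennreal (dist x y0 powr p) \<partial>\<nu>)"
    unfolding marg(2)[symmetric] by (intro nn_integral_distr[symmetric]) (simp_all add: meas m)
  \<comment> \<open>The route x, x0, y0, y has three legs, so \<open>dist x y\<close> is at most
    three times the longest one; the p-th power of a maximum is at most the sum of the p-th
    powers.\<close>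
  let ?b = "\<lambda>z. ennreal (3 powr p) * (ennreal (dist (fst z) x0 powr p) + ennreal (dist (snd z) y0 powr p) +
      ennreal (dist x0 y0 powr p))"
  have "transport_cost p \<theta> \<le> (\<integral>\<^sup>+ z. ?b z \<partial>\<theta>)"
    unfolding transport_cost_def
  proof (rule nn_integral_mono)
    fix z :: "'a \<times> 'a"
    obtain x y where z: "z = (x, y)" by fastforce
    let ?a = "dist x x0" and ?c = "dist y y0" and ?d = "dist x0 y0"
    let ?m = "max ?a (max ?c ?d)"
    have "dist x y \<le> ?a + ?d + ?c"
      using dist_triangle[of x y x0] dist_triangle[of x0 y y0] by (simp add: dist_commute)
    also have "\<dots> \<le> 3 * ?m" by simp
    finally have "dist x y powr p \<le> (3 * ?m) powr p"
      using p by (intro powr_mono2) auto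
    also have "\<dots> = 3 powr p * ?m powr p"
      by (intro powr_mult)
    also have "?m powr p \<le> ?a powr p + ?c powr p + ?d powr p"
      by (auto simp: max_def)
    finally have "dist x y powr p \<le> 3 powr p * (?a powr p + ?c powr p + ?d powr p)"
      by simp
    then show "(case z of (x, y) \<Rightarrow> ennreal (dist x y powr p)) \<le> ?b z"
      by (simp add: z flip: ennreal_plus ennreal_mult)
  qed
  also have "\<dots> = ennreal (3 powr p) * ((\<integral>\<^sup>+ x. ennreal (dist x x0 powr p) \<partial>\<mu>) +
      (\<integral>\<^sup>+ x. ennreal (dist x y0 powr p) \<partial>\<nu>) + ennreal (dist x0 y0 powr p))"
    using m1 m2 by (simp add: nn_integral_cmult nn_integral_add i1 i2 emeasure_space_1)
  also have "\<dots> < \<infinity>"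
    using x0 y0 by (auto simp: ennreal_mult_less_top)
  finally show ?thesis .
qed

lemma distr_ends_in_Cpl:
  fixes \<mu> \<nu> :: "'a::metric_space measure"
  assumes "\<pi> \<in> path_plans \<mu> \<nu>"
  shows "distr \<pi> borel ends \<in> Cpl \<mu> \<nu>"
    and "transport_cost p (distr \<pi> borel ends) =
      (\<integral>\<^sup>+ \<gamma>. ennreal (dist (eval_at 0 \<gamma>) (eval_at 1 \<gamma>) powr p) \<partial>\<pi>)"
proof -
  have sets: "sets \<pi> = sets borel" and "prob_space \<pi>"
    and marg: "distr \<pi> borel (eval_at 0) = \<mu>" "distr \<pi> borel (eval_at 1) = \<nu>"
    using assms by (auto simp: path_plans_def borel_probs_def)
  interpret prob_space \<pi> by fact
  have ends: "ends \<in> measurable \<pi> borel"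
    unfolding measurable_cong_sets[OF sets refl] by (rule measurable_ends)
  have "distr (distr \<pi> borel ends) borel fst = \<mu>" "distr (distr \<pi> borel ends) borel snd = \<nu>"
    using ends by (simp_all add: distr_distr o_def ends_def marg)
  then show "distr \<pi> borel ends \<in> Cpl \<mu> \<nu>"
    using prob_space_distr[OF ends] by (simp add: Cpl_def borel_probs_def)
  show "transport_cost p (distr \<pi> borel ends) =
      (\<integral>\<^sup>+ \<gamma>. ennreal (dist (eval_at 0 \<gamma>) (eval_at 1 \<gamma>) powr p) \<partial>\<pi>)"
    unfolding transport_cost_def using ends by (subst nn_integral_distr) (auto simp: ends_def)
qed

text \<open>Because the common value is finite, the integrals can be subtracted, and the nonnegative
  difference has integral zero.\<close>

lemma AE_le_if_nn_integral_eq: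
  assumes f: "f \<in> borel_measurable M" and g: "g \<in> borel_measurable M"
    and le: "\<And>x. g x \<le> f x" and eq: "(\<integral>\<^sup>+ x. f x \<partial>M) = (\<integral>\<^sup>+ x. g x \<partial>M)"
    and fin: "(\<integral>\<^sup>+ x. g x \<partial>M) \<noteq> \<infinity>"
  shows "AE x in M. f x \<le> g x"
proof -
  have "(\<integral>\<^sup>+ x. f x - g x \<partial>M) = 0"
    using nn_integral_diff[OF f g fin] le eq fin by simp
  then have "AE x in M. f x - g x = 0"
    using f g by (subst (asm) nn_integral_0_iff_AE) auto
  then show ?thesis
    by (rule AE_mp) (auto intro!: AE_I2 simp: diff_eq_0_iff_ennreal)
qed

text \<open>Everything is compared with \<open>W\<close> after multiplication by
  \<open>\<kappa>\<close>: \<open>W\<close> is at most the transport cost of the endpoint law, which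
  is at most \<open>\<kappa>\<close> times the energy, and a geodesic lift of an optimal coupling
  has equality throughout. A plan is thus minimal exactly when both inequalities are equalities, and
  these are the two conditions of the characterization.\<close>

theorem corollary1p11:
  fixes \<mu> \<nu> :: "'a::polish_space measure" and p \<alpha> :: real
  assumes "geodesic_space TYPE('a)"
    and "1 < p" and "0 < \<alpha>" and "\<alpha> < 1"
    and "\<mu> \<in> P_moment p" and "\<nu> \<in> P_moment p"
  shows "(\<exists>\<pi>. is_arg_min (path_energy \<alpha> p) (\<lambda>\<pi>. \<pi> \<in> path_plans \<mu> \<nu>) \<pi>) \<and>
    enn_powr (Wasserstein p \<mu> \<nu>) p =
      ennreal (1 - 2 powr (- (p - \<alpha> * p))) * (INF \<pi>\<in>path_plans \<mu> \<nu>. path_energy \<alpha> p \<pi>) \<and>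
    (\<forall>\<pi>\<in>path_plans \<mu> \<nu>.
      is_arg_min (path_energy \<alpha> p) (\<lambda>\<pi>. \<pi> \<in> path_plans \<mu> \<nu>) \<pi> \<longleftrightarrow>
      distr \<pi> borel (\<lambda>\<gamma>. (eval_at 0 \<gamma>, eval_at 1 \<gamma>)) \<in> OptCpl p \<mu> \<nu> \<and>
      emeasure \<pi> Geo = 1)"
proof -
  note params = \<open>1 < p\<close> \<open>0 < \<alpha>\<close> \<open>\<alpha> < 1\<close>
  let ?P = "path_plans \<mu> \<nu>"
  let ?L = "\<lambda>\<gamma> :: 'a path_space. ennreal (dist (eval_at 0 \<gamma>) (eval_at 1 \<gamma>) powr p)"
  define \<kappa> where "\<kappa> = ennreal (1 - level_ratio \<alpha> p)"
  have \<kappa>: "\<kappa> \<noteq> 0" "\<kappa> \<noteq> \<infinity>"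
    using level_ratio_bounds[OF params] by (auto simp: \<kappa>_def)
  define W where "W = (INF \<theta>\<in>Cpl \<mu> \<nu>. transport_cost p \<theta>)"
  have probs: "\<mu> \<in> borel_probs" "\<nu> \<in> borel_probs"
    using assms(5,6) by (auto simp: P_moment_def)
  have p0: "p > 0" using params by simp
  have OptCpl_iff: "\<theta> \<in> OptCpl p \<mu> \<nu> \<longleftrightarrow> transport_cost p \<theta> = W" if "\<theta> \<in> Cpl \<mu> \<nu>" for \<theta>
  proof
    assume "\<theta> \<in> OptCpl p \<mu> \<nu>"
    then have "transport_cost p \<theta> \<le> W"
      unfolding W_def by (intro INF_greatest) (auto simp: OptCpl_def is_arg_min_def not_less)
    then show "transport_cost p \<theta> = W"
      using that by (intro antisym) (auto simp: W_def intro: INF_lower)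
  next
    assume "transport_cost p \<theta> = W"
    then show "\<theta> \<in> OptCpl p \<mu> \<nu>"
      using that by (auto simp: OptCpl_def is_arg_min_def not_less W_def intro: INF_lower)
  qed
  obtain \<theta> where \<theta>: "\<theta> \<in> OptCpl p \<mu> \<nu>"
    using OptCpl_nonempty[OF probs p0] .
  then have \<theta>_Cpl: "\<theta> \<in> Cpl \<mu> \<nu>" by (simp add: OptCpl_def is_arg_min_def)
  then have sets_\<theta>: "sets \<theta> = sets borel" and prob_\<theta>: "prob_space \<theta>"
    and marg: "distr \<theta> borel fst = \<mu>" "distr \<theta> borel snd = \<nu>"
    by (auto simp: Cpl_def borel_probs_def)
  have W: "transport_cost p \<theta> = W" using \<theta> \<theta>_Cpl OptCpl_iff by blast
  have W_fin: "W \<noteq> \<infinity>"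
    using transport_cost_finite[OF p0 assms(5,6) \<theta>_Cpl] W by simp

  have space_P: "sets \<pi> = sets borel" "space \<pi> = UNIV" "prob_space \<pi>" if "\<pi> \<in> ?P" for \<pi>
    using that sets_eq_imp_space_eq[of \<pi> borel] by (auto simp: path_plans_def borel_probs_def)
  have Geo_iff: "emeasure \<pi> Geo = 1 \<longleftrightarrow> (AE \<gamma> in \<pi>. \<gamma> \<in> Geo)" if "\<pi> \<in> ?P" for \<pi>
  proof -
    interpret prob_space \<pi> using space_P(3)[OF that] .
    have "Geo \<in> sets \<pi>" using borel_closed[OF closed_Geo] by (simp add: space_P[OF that])
    then show ?thesis using prob_eq_1[of Geo] by (simp add: emeasure_eq_measure)
  qed
  have energy: "\<kappa> * path_energy \<alpha> p \<pi> = (\<integral>\<^sup>+ \<gamma>. \<kappa> * enn_powr (besov \<alpha> p \<gamma>) p \<partial>\<pi>)"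
    and energy_ge: "transport_cost p (distr \<pi> borel ends) \<le> \<kappa> * path_energy \<alpha> p \<pi>"
    and energy_W: "W \<le> \<kappa> * path_energy \<alpha> p \<pi>"
    and energy_Geo: "emeasure \<pi> Geo = 1 \<Longrightarrow> \<kappa> * path_energy \<alpha> p \<pi> = transport_cost p (distr \<pi> borel ends)"
    if \<pi>: "\<pi> \<in> ?P" for \<pi>
  proof -
    have "(\<lambda>\<gamma>. enn_powr (besov \<alpha> p \<gamma>) p) \<in> borel_measurable \<pi>"
      unfolding measurable_cong_sets[OF space_P(1)[OF \<pi>] refl] by measurable
    then show energy: "\<kappa> * path_energy \<alpha> p \<pi> = (\<integral>\<^sup>+ \<gamma>. \<kappa> * enn_powr (besov \<alpha> p \<gamma>) p \<partial>\<pi>)"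
      unfolding path_energy_def by (rule nn_integral_cmult[symmetric])
    show *: "transport_cost p (distr \<pi> borel ends) \<le> \<kappa> * path_energy \<alpha> p \<pi>"
      unfolding energy distr_ends_in_Cpl(2)[OF \<pi>] unfolding \<kappa>_def
      by (intro nn_integral_mono besov_ge[OF params])
    show "W \<le> \<kappa> * path_energy \<alpha> p \<pi>"
      using INF_lower[OF distr_ends_in_Cpl(1)[OF \<pi>], of "transport_cost p"] *
      unfolding W_def by (rule order_trans)
    assume "emeasure \<pi> Geo = 1"
    then have "AE \<gamma> in \<pi>. \<gamma> \<in> Geo" by (simp add: Geo_iff[OF \<pi>])
    then show "\<kappa> * path_energy \<alpha> p \<pi> = transport_cost p (distr \<pi> borel ends)"
      unfolding energy distr_ends_in_Cpl(2)[OF \<pi>] unfolding \<kappa>_def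
      by (intro nn_integral_cong_AE) (auto simp: besov_Geo[OF params])
  qed

  \<comment> \<open>The plan is the image of \<open>\<theta>\<close> under a section of
    \<open>ends\<close> chosen for \<open>\<theta>\<close> itself. A right inverse almost everywhere
    is enough for the endpoint law of this plan to be \<open>\<theta>\<close>.\<close>
  obtain \<pi>0 where \<pi>0: "\<pi>0 \<in> ?P" "emeasure \<pi>0 Geo = 1" "distr \<pi>0 borel ends = \<theta>"
  proof -
    obtain D :: "nat \<Rightarrow> 'a path_space" where D: "\<And>\<gamma> \<epsilon>. \<gamma> \<in> Geo \<Longrightarrow> \<epsilon> > 0 \<Longrightarrow> \<exists>i. dist \<gamma> (D i) < \<epsilon>"
      using dense_sequence_Geo by blast
    obtain s where s: "s \<in> borel_measurable borel" and sec: "AE z in \<theta>. s z \<in> Geo \<and> ends (s z) = z"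
      using AE_borel_section[OF closed_Geo continuous_on_ends ends_Geo[OF assms(1)] D sets_\<theta> prob_\<theta>] .
    have s': "s \<in> measurable \<theta> borel"
      using s unfolding measurable_cong_sets[OF sets_\<theta> refl] .
    have "distr (distr \<theta> borel s) borel ends = distr \<theta> borel (\<lambda>z. z)"
      using sec s' by (subst distr_distr) (auto intro!: distr_cong_AE simp: o_def measurable_cong_sets[OF sets_\<theta> refl])
    also have "\<dots> = \<theta>"
      by (rule distr_id2) (simp add: sets_\<theta>)
    finally have e: "distr (distr \<theta> borel s) borel ends = \<theta>" .
    have "distr (distr (distr \<theta> borel s) borel ends) borel fst = distr (distr \<theta> borel s) borel (eval_at 0)"
      "distr (distr (distr \<theta> borel s) borel ends) borel snd = distr (distr \<theta> borel s) borel (eval_at 1)"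
      by (subst distr_distr; simp add: o_def ends_def)+
    then have P: "distr \<theta> borel s \<in> ?P"
      using marg prob_space.prob_space_distr[OF prob_\<theta> s'] unfolding e
      by (simp add: path_plans_def borel_probs_def)
    have "AE \<gamma> in distr \<theta> borel s. \<gamma> \<in> Geo"
      using sec borel_closed[OF closed_Geo] s' by (subst AE_distr_iff) auto
    then show thesis
      using that[OF P _ e] Geo_iff[OF P] by simp
  qed
  have energy0: "\<kappa> * path_energy \<alpha> p \<pi>0 = W"
    using energy_Geo[OF \<pi>0(1,2)] \<pi>0(3) W by simp
  \<comment> \<open>Cancelling in \<open>ennreal\<close> requires that \<open>\<kappa>\<close> be
    neither zero nor infinite.\<close>
  have le_iff: "path_energy \<alpha> p \<pi> \<le> path_energy \<alpha> p \<pi>' \<longleftrightarrow> \<kappa> * path_energy \<alpha> p \<pi> \<le> \<kappa> * path_energy \<alpha> p \<pi>'" for \<pi> \<pi>'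
    using \<kappa> by (simp add: ennreal_mult_le_mult_iff)
  have arg_min_iff: "is_arg_min (path_energy \<alpha> p) (\<lambda>\<pi>. \<pi> \<in> ?P) \<pi> \<longleftrightarrow> \<kappa> * path_energy \<alpha> p \<pi> = W"
    if "\<pi> \<in> ?P" for \<pi>
  proof
    assume "is_arg_min (path_energy \<alpha> p) (\<lambda>\<pi>. \<pi> \<in> ?P) \<pi>"
    then have "path_energy \<alpha> p \<pi> \<le> path_energy \<alpha> p \<pi>0"
      using \<pi>0(1) by (auto simp: is_arg_min_def not_less)
    then show "\<kappa> * path_energy \<alpha> p \<pi> = W"
      using energy_W[OF that] energy0 by (simp add: le_iff)
  next
    assume "\<kappa> * path_energy \<alpha> p \<pi> = W"
    then show "is_arg_min (path_energy \<alpha> p) (\<lambda>\<pi>. \<pi> \<in> ?P) \<pi>"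
      using energy_W that by (auto simp: is_arg_min_def not_less le_iff)
  qed
  have min0: "is_arg_min (path_energy \<alpha> p) (\<lambda>\<pi>. \<pi> \<in> ?P) \<pi>0"
    using arg_min_iff[OF \<pi>0(1)] energy0 by simp
  have INF: "(INF \<pi>\<in>?P. path_energy \<alpha> p \<pi>) = path_energy \<alpha> p \<pi>0"
    using min0 by (intro antisym INF_lower INF_greatest) (auto simp: is_arg_min_def not_less)
  have "is_arg_min (path_energy \<alpha> p) (\<lambda>\<pi>. \<pi> \<in> ?P) \<pi> \<longleftrightarrow>
      distr \<pi> borel ends \<in> OptCpl p \<mu> \<nu> \<and> emeasure \<pi> Geo = 1" if \<pi>: "\<pi> \<in> ?P" for \<pi>
    unfolding arg_min_iff[OF \<pi>] OptCpl_iff[OF distr_ends_in_Cpl(1)[OF \<pi>]]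
  proof
    assume E: "\<kappa> * path_energy \<alpha> p \<pi> = W"
    have "W \<le> transport_cost p (distr \<pi> borel ends)"
      unfolding W_def by (rule INF_lower[OF distr_ends_in_Cpl(1)[OF \<pi>]])
    then have c: "transport_cost p (distr \<pi> borel ends) = W"
      using energy_ge[OF \<pi>] E by simp
    \<comment> \<open>Both sides have integral \<open>W\<close>, which is finite, so the pointwise
      bound \<open>besov_ge\<close> can be reversed almost everywhere; paths satisfying the reverse
      bound are geodesics.\<close>
    have "AE \<gamma> in \<pi>. \<kappa> * enn_powr (besov \<alpha> p \<gamma>) p \<le> ?L \<gamma>"
    proof (rule AE_le_if_nn_integral_eq)
      show "(\<lambda>\<gamma>. \<kappa> * enn_powr (besov \<alpha> p \<gamma>) p) \<in> borel_measurable \<pi>"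
        unfolding measurable_cong_sets[OF space_P(1)[OF \<pi>] refl] by measurable
      show "?L \<in> borel_measurable \<pi>"
        unfolding measurable_cong_sets[OF space_P(1)[OF \<pi>] refl]
        using measurable_compose[OF measurable_ends measurable_cost] by (simp add: ends_def)
      show "?L \<gamma> \<le> \<kappa> * enn_powr (besov \<alpha> p \<gamma>) p" for \<gamma>
        unfolding \<kappa>_def by (rule besov_ge[OF params])
      show "(\<integral>\<^sup>+ \<gamma>. \<kappa> * enn_powr (besov \<alpha> p \<gamma>) p \<partial>\<pi>) = (\<integral>\<^sup>+ \<gamma>. ?L \<gamma> \<partial>\<pi>)"
        "(\<integral>\<^sup>+ \<gamma>. ?L \<gamma> \<partial>\<pi>) \<noteq> \<infinity>"
        using energy[OF \<pi>] E c W_fin by (simp_all add: distr_ends_in_Cpl(2)[OF \<pi>])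
    qed
    then have "AE \<gamma> in \<pi>. \<gamma> \<in> Geo"
      unfolding \<kappa>_def by (rule AE_mp) (auto intro!: AE_I2 besov_le_imp_Geo[OF params])
    then show "transport_cost p (distr \<pi> borel ends) = W \<and> emeasure \<pi> Geo = 1"
      using c Geo_iff[OF \<pi>] by simp
  next
    assume "transport_cost p (distr \<pi> borel ends) = W \<and> emeasure \<pi> Geo = 1"
    then show "\<kappa> * path_energy \<alpha> p \<pi> = W"
      using energy_Geo[OF \<pi>] by simp
  qed
  moreover have "enn_powr (Wasserstein p \<mu> \<nu>) p = \<kappa> * (INF \<pi>\<in>?P. path_energy \<alpha> p \<pi>)"
    unfolding INF energy0 Wasserstein_def W_def using p0 by (rule enn_powr_inverse_powr)
  ultimately show ?thesis
    using min0 unfolding \<kappa>_def level_ratio_def[OF params] ends_def[abs_def] by blast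
qed

end
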